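(* Let $\delta_0=\frac14-\frac{2}{\pi^2}$. For every $\epsilon>0$ there exists $x_0$ such that for all $x>x_0$ the following holds. Let $A\subseteq[1,x]\cap\mathbb{N}$ be a set of integers such that $A+A$ contains no squarefree integer, and suppose $|A|>(\delta_0+\epsilon)x$. Then either $A$ is a subset of $4\mathbb{N}$, of $9\mathbb{N}$, or of $4\mathbb{N}+2$, or all elements of $A$ are even and there exists $a\in\{1,\ldots,8\}$ such that for every $n\in A$: $n\equiv 2\pmod 4 \iff n\equiv a\pmod 9$, and $n\equiv 0\pmod 4\iff n\equiv -a\pmod 9$.
   Context: $A+A=\{a+b: a,b\in A\}$. For a positive integer $m$ and an integer $r$, $m\mathbb{N}+r$ denotes the set of positive integers congruent to $r$ modulo $m$. *)

theory Defs
  imports Complex_Main "HOL-Computational_Algebra.Squarefree"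
begin

definition delta0 :: real where
  "delta0 = 1/4 - 2 / pi^2"

end

theory Submission
  imports Defs "HOL-Analysis.Analysis" "HOL-Real_Asymp.Real_Asymp"
    "HOL-Number_Theory.Number_Theory"
begin

text \<open>
  If \<open>n + b\<close> is not squarefree and not divisible by \<open>4\<close>, some odd prime square divides it, and among
  the \<open>n\<close> in a fixed class modulo \<open>4\<close> this has relative density \<open>1 - 8/\<pi>\<^sup>2 = 4 \<delta>\<^sub>0\<close>, uniformly in
  \<open>b \<le> x\<close>. Split \<open>A\<close> into its classes \<open>A\<^sub>i\<close> modulo \<open>4\<close>; the neighbours of \<open>A\<^sub>i\<close> are the \<open>b \<in> A\<close> with
  \<open>4\<close> not dividing \<open>i + b\<close>. If the neighbours lie in at least two classes modulo \<open>p\<^sup>2\<close>, then each \<open>n \<in> A\<^sub>i\<close>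
  has a neighbour \<open>b\<close>, depending only on \<open>n mod p\<^sup>2\<close>, with \<open>p\<^sup>2\<close> not dividing \<open>n + b\<close>, so the prime \<open>p\<close>
  can be dropped from the sieve. Distinguishing for which of \<open>p = 3, 5, 7\<close> this happens, one finds that
  the total density is at most \<open>\<delta>\<^sub>0\<close> unless \<open>A\<close> is one of the exceptional sets. The delicate case has
  \<open>A\<^sub>0\<close> or \<open>A\<^sub>2\<close> of density close to \<open>\<delta>\<^sub>0\<close> and very few other elements; there the least prime that can
  be dropped is compared with the product of the smaller ones.
\<close>

section \<open>The sieve for prime squares\<close>

definition sqf_density :: real where
  "sqf_density = 6 / pi\<^sup>2"

text \<open>All later numerical comparisons of densities rest on these two decimals.\<close>

lemma sqf_density_bounds: "0.606 \<le> sqf_density" "sqf_density \<le> 0.61"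
proof -
  have "pi\<^sup>2 \<le> 3.142\<^sup>2" "3.141\<^sup>2 \<le> pi\<^sup>2"
    using pi_approx by (auto intro!: power_mono)
  then have "pi\<^sup>2 \<le> 9.9" "9.84 \<le> pi\<^sup>2"
    by (auto simp: power2_eq_square)
  then show "0.606 \<le> sqf_density" "sqf_density \<le> 0.61"
    by (auto simp: sqf_density_def field_simps)
qed

lemma delta0_eq: "delta0 = 1/4 - sqf_density / 3"
  by (simp add: delta0_def sqf_density_def)

section \<open>Partial Euler products of 1/zeta(2)\<close>

definition sieve_factor :: "nat set \<Rightarrow> real" where
  "sieve_factor S = (\<Prod>p\<in>S. 1 - 1 / (real p)\<^sup>2)"

lemma sieve_factor_pos:
  assumes "\<forall>p\<in>S. prime p"
  shows "sieve_factor S > 0"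
  unfolding sieve_factor_def
proof (rule prod_pos)
  fix p assume "p \<in> S"
  then have "1 < (real p)\<^sup>2"
    using assms prime_gt_1_nat by (simp add: one_less_power)
  then show "0 < 1 - 1 / (real p)\<^sup>2" by (auto simp: divide_less_eq_1)
qed

definition coprime_nats :: "nat set \<Rightarrow> nat set" where
  "coprime_nats S = {n. n > 0 \<and> (\<forall>p\<in>S. \<not> p dvd n)}"

lemma inverse_squares_summable_on: "(\<lambda>n. 1 / (real n)\<^sup>2) summable_on S"
proof -
  have "(\<lambda>n. 1 / (real n)\<^sup>2) summable_on UNIV"
    using inverse_power_summable[of 2, where 'a = real]
    by (intro norm_summable_imp_summable_on) (simp add: field_simps)
  then show ?thesis by (rule summable_on_subset_banach) simp
qed

text \<open>The Euler factors of \<open>\<zeta>(2)\<close> at the primes of \<open>S\<close> are removed one at a time.\<close>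

lemma infsum_coprime_nats:
  assumes "finite S" "\<forall>p\<in>S. prime p"
  shows "infsum (\<lambda>n. 1 / (real n)\<^sup>2) (coprime_nats S) = sieve_factor S * (pi\<^sup>2 / 6)"
  using assms
proof (induction S)
  case empty
  have "(\<lambda>n. 1 / (real (Suc n))\<^sup>2) sums (pi\<^sup>2 / 6)"
    using inverse_squares_sums by (simp add: add.commute)
  then have "infsum (\<lambda>n. 1 / (real (Suc n))\<^sup>2) UNIV = pi\<^sup>2 / 6"
    by (intro infsumI norm_summable_imp_has_sum) (auto simp: sums_iff)
  moreover have "coprime_nats {} = Suc ` UNIV"
    by (auto simp: coprime_nats_def image_iff gr0_conv_Suc)
  ultimately show ?case
    by (simp add: infsum_reindex sieve_factor_def o_def)
next
  case (insert p S)
  let ?f = "\<lambda>n. 1 / (real n)\<^sup>2"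
  have p: "prime p" and p0: "p > 0" using insert.prems prime_gt_0_nat by auto
  have "\<not> q dvd p" if "q \<in> S" for q
    using that insert.hyps insert.prems primes_dvd_imp_eq[of q p] by auto
  then have "p * m \<in> coprime_nats S \<longleftrightarrow> m \<in> coprime_nats S" for m
    using p0 insert.prems by (auto simp: coprime_nats_def prime_dvd_mult_iff)
  then have img: "(\<lambda>m. p * m) ` coprime_nats S = {n \<in> coprime_nats S. p dvd n}"
    by (auto elim!: dvdE)
  have "coprime_nats (insert p S) = coprime_nats S - (\<lambda>m. p * m) ` coprime_nats S"
    unfolding img by (auto simp: coprime_nats_def)
  then have "infsum ?f (coprime_nats (insert p S))
      = infsum ?f (coprime_nats S) - infsum ?f ((\<lambda>m. p * m) ` coprime_nats S)"
    using img by (simp add: infsum_Diff inverse_squares_summable_on)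
  also have "infsum ?f ((\<lambda>m. p * m) ` coprime_nats S)
      = infsum (\<lambda>m. 1 / (real p)\<^sup>2 * ?f m) (coprime_nats S)"
    using p0 by (subst infsum_reindex) (auto simp: inj_on_def o_def power_mult_distrib)
  also have "\<dots> = 1 / (real p)\<^sup>2 * infsum ?f (coprime_nats S)"
    by (rule infsum_cmult_right')
  finally show ?case
    using insert by (simp add: sieve_factor_def algebra_simps)
qed

text \<open>The sum over the integers prime to \<open>S\<close> contains the term for
  \<open>n = 1\<close>, so it is at least 1. This bounds the partial Euler product below by the
  complete one without handling an infinite product.\<close>

lemma sieve_factor_ge:
  assumes "finite S" "\<forall>p\<in>S. prime p"
  shows "sqf_density \<le> sieve_factor S"
proof -
  have "1 \<in> coprime_nats S"
    using assms by (auto simp: coprime_nats_def)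
  then have "infsum (\<lambda>n. 1 / (real n)\<^sup>2) {1} \<le> infsum (\<lambda>n. 1 / (real n)\<^sup>2) (coprime_nats S)"
    by (intro infsum_mono2 inverse_squares_summable_on) auto
  then show ?thesis
    using infsum_coprime_nats[OF assms] by (simp add: sqf_density_def field_simps)
qed

text \<open>The density of the integers divisible by the square of some prime outside \<open>Q\<close>.\<close>

definition square_density :: "nat set \<Rightarrow> real" where
  "square_density Q = 1 - sqf_density / sieve_factor Q"

lemma square_density_nonneg:
  assumes "finite Q" "\<forall>p\<in>Q. prime p"
  shows "0 \<le> square_density Q"
  using sieve_factor_ge[OF assms] sieve_factor_pos[OF assms(2)]
  by (simp add: square_density_def)

text \<open>Dividing the bound for \<open>S \<union> Q\<close> by the factor of \<open>Q\<close>
  shows that a finite product over primes outside \<open>Q\<close> never falls below the complete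
  one. Truncating the sieve therefore costs nothing in an upper bound.\<close>

lemma sieve_factor_ge_disjoint:
  assumes "finite S" "\<forall>p\<in>S. prime p" "finite Q" "\<forall>p\<in>Q. prime p" "S \<inter> Q = {}"
  shows "1 - square_density Q \<le> sieve_factor S"
proof -
  have "sqf_density \<le> sieve_factor (S \<union> Q)"
    using assms by (intro sieve_factor_ge) auto
  also have "\<dots> = sieve_factor S * sieve_factor Q"
    using assms by (simp add: sieve_factor_def prod.union_disjoint)
  finally show ?thesis
    using sieve_factor_pos[OF assms(4)] by (simp add: square_density_def field_simps)
qed

lemma square_density_2: "square_density {2} = 1 - 4/3 * sqf_density"
  by (simp add: square_density_def sieve_factor_def field_simps)

lemma square_density_2_3: "square_density {2,3} = 1 - 3/2 * sqf_density"
  by (simp add: square_density_def sieve_factor_def field_simps)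

lemma square_density_2_5: "square_density {2,5} = 1 - 25/18 * sqf_density"
  by (simp add: square_density_def sieve_factor_def field_simps)

lemma square_density_2_7: "square_density {2,7} = 1 - 49/36 * sqf_density"
  by (simp add: square_density_def sieve_factor_def field_simps)

lemma square_density_2_3_5: "square_density {2,3,5} = 1 - 25/16 * sqf_density"
  by (simp add: square_density_def sieve_factor_def field_simps)

lemma square_density_2_3_5_7: "square_density {2,3,5,7} = 1 - 1225/768 * sqf_density"
  by (simp add: square_density_def sieve_factor_def field_simps)

text \<open>The last term is what dropping \<open>p\<close> gains over
  \<open>square_density {2}\<close>; in this form it can be compared with the density of the other
  parts.\<close>

lemma square_density_2_prime:
  assumes "prime p" "p \<noteq> 2"
  shows "square_density {2,p} = 1 - 4/3 * sqf_density - 4/3 * sqf_density / ((real p)\<^sup>2 - 1)"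
proof -
  have "1 < (real p)\<^sup>2"
    using assms prime_gt_1_nat by (simp add: one_less_power)
  then show ?thesis
    using assms by (simp add: square_density_def sieve_factor_def field_simps)
qed

section \<open>Counting in residue classes\<close>

text \<open>Here \<open>j\<close> represents \<open>-b\<close> modulo \<open>m\<close>, which avoids
  subtraction on the naturals.\<close>

lemma dvd_add_iff_cong:
  fixes m n j b :: nat
  assumes "m dvd j + b"
  shows "m dvd n + b \<longleftrightarrow> [n = j] (mod m)"
proof -
  have "m dvd n + b \<longleftrightarrow> [n + b = j + b] (mod m)"
    using assms by (simp add: cong_def dvd_eq_mod_eq_0)
  then show ?thesis by (simp only: cong_add_rcancel_nat)
qed

lemma obtain_complement:
  fixes m b :: nat
  assumes "m \<ge> 1"
  obtains j where "m dvd j + b"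
proof
  have "b \<le> m * b" using assms by simp
  then show "m dvd (m * b - b) + b" by simp
qed

text \<open>Any \<open>M\<close> consecutive integers contain exactly one element of the class, so
  induction in steps of \<open>M\<close> keeps the error at most 1.\<close>

lemma card_residue_class:
  assumes "M \<ge> 1"
  shows "\<bar>real (card {n\<in>{1..X}. [n = i] (mod M)}) - real X / real M\<bar> \<le> 1"
proof -
  define C where "C Y = card {n\<in>{1..Y}. [n = i] (mod M)}" for Y :: nat
  have step: "C (Y + M) = C Y + 1" for Y
  proof -
    obtain k where k: "k \<in> {Y+1..Y+M}" "[k = i] (mod M)"
    proof -
      \<comment> \<open>The least integer above \<open>Y\<close> congruent to \<open>i\<close>; the
        remainder is taken over the integers because the difference may be negative.\<close>
      define k where "k = Y + 1 + nat ((int i - int (Y + 1)) mod int M)"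
      have "k \<in> {Y+1..Y+M}"
        using assms nat_less_iff[of "(int i - int (Y+1)) mod int M" M] by (auto simp: k_def)
      moreover have "[int k = int i] (mod int M)"
        using assms mod_add_right_eq[of "int (Y + 1)" "int i - int (Y + 1)" "int M"]
        by (simp add: k_def cong_def add.assoc)
      ultimately show ?thesis using that cong_int_iff by blast
    qed
    have "{n\<in>{1..Y+M}. [n = i] (mod M)} = insert k {n\<in>{1..Y}. [n = i] (mod M)}"
    proof (intro equalityI subsetI)
      fix n assume n: "n \<in> {n\<in>{1..Y+M}. [n = i] (mod M)}"
      show "n \<in> insert k {n\<in>{1..Y}. [n = i] (mod M)}"
      proof (cases "n \<le> Y")
        case False
        have "int M dvd int n - int k"
          using n k cong_int_iff cong_iff_dvd_diff cong_sym cong_trans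
          by (metis (mono_tags, lifting) mem_Collect_eq)
        moreover have "\<bar>int n - int k\<bar> < int M" using n k False by auto
        ultimately have "n = k"
          using zdvd_imp_le by (smt (verit) dvd_imp_le_int of_nat_eq_iff)
        then show ?thesis by simp
      qed (use n in auto)
    qed (use k in auto)
    then show ?thesis using k by (simp add: C_def)
  qed
  have "\<bar>real (C Y) - real Y / real M\<bar> \<le> 1" for Y
  proof (induction Y rule: less_induct)
    case (less Y)
    show ?case
    proof (cases "Y < M")
      case True
      have "C Y \<le> C (0 + M)"
        unfolding C_def using True by (intro card_mono) auto
      also have "\<dots> = 1" using step[of 0] by (simp add: C_def)
      finally have "real (C Y) \<le> 1" by simp
      moreover have "real Y / real M \<le> 1" using True by (simp add: field_simps)
      moreover have "0 \<le> real Y / real M" by simp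
      ultimately show ?thesis by linarith
    next
      case False
      then have "C Y = C (Y - M) + 1" using step[of "Y - M"] by simp
      moreover have "real Y / real M = real (Y - M) / real M + 1"
        using False assms by (simp add: of_nat_diff field_simps)
      ultimately show ?thesis using less[of "Y - M"] False assms by auto
    qed
  qed
  then show ?thesis by (simp add: C_def)
qed

text \<open>Induction on \<open>T\<close> for all \<open>M\<close> and \<open>i\<close> at once: by
  the Chinese remainder theorem the \<open>n\<close> in the class with \<open>p\<^sup>2\<close>
  dividing \<open>n + b\<close> form one class modulo \<open>M * p\<^sup>2\<close>. The new count is
  thus a difference of two old ones, and the error doubles with each prime.\<close>

lemma card_avoiding_squares:
  assumes "finite T" "\<forall>p\<in>T. prime p" "M \<ge> 1" "\<forall>p\<in>T. \<not> p dvd M"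
  shows "\<bar>real (card {n\<in>{1..X}. [n = i] (mod M) \<and> (\<forall>p\<in>T. \<not> p\<^sup>2 dvd n + b)})
           - sieve_factor T * X / M\<bar> \<le> 2 ^ card T"
  using assms
proof (induction T arbitrary: M i)
  case empty
  then show ?case using card_residue_class[of M X i] by (simp add: sieve_factor_def)
next
  case (insert p T)
  let ?A = "\<lambda>M i. {n\<in>{1..X}. [n = i] (mod M) \<and> (\<forall>p\<in>T. \<not> p\<^sup>2 dvd n + b)}"
  let ?B = "{n\<in>{1..X}. [n = i] (mod M) \<and> (\<forall>q\<in>insert p T. \<not> q\<^sup>2 dvd n + b)}"
  have p: "prime p" and M: "M \<ge> 1" using insert.prems by auto
  have p0: "p > 0" using p prime_gt_0_nat by blast
  have "coprime M (p\<^sup>2)"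
    using insert.prems prime_imp_coprime[of p M] by (auto simp: coprime_commute)
  obtain j' where j': "p\<^sup>2 dvd j' + b" using obtain_complement[of "p\<^sup>2" b] p0 by auto
  obtain j where j: "[j = i] (mod M)" "[j = j'] (mod p\<^sup>2)"
    using \<open>coprime M (p\<^sup>2)\<close> binary_chinese_remainder_nat by blast
  have cls: "[n = j] (mod M * p\<^sup>2) \<longleftrightarrow> [n = i] (mod M) \<and> p\<^sup>2 dvd n + b" for n
    unfolding dvd_add_iff_cong[OF j']
  proof
    assume n: "[n = j] (mod M * p\<^sup>2)"
    show "[n = i] (mod M) \<and> [n = j'] (mod p\<^sup>2)"
      using cong_dvd_modulus_nat[OF n, of M] cong_dvd_modulus_nat[OF n, of "p\<^sup>2"] j
      by (auto intro: cong_trans)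
  next
    assume n: "[n = i] (mod M) \<and> [n = j'] (mod p\<^sup>2)"
    then have "[n = j] (mod M)" "[n = j] (mod p\<^sup>2)" using j cong_sym cong_trans by blast+
    then show "[n = j] (mod M * p\<^sup>2)"
      using \<open>coprime M (p\<^sup>2)\<close> by (intro coprime_cong_mult_nat)
  qed
  have "?A (M * p\<^sup>2) j \<subseteq> ?A M i" "?B = ?A M i - ?A (M * p\<^sup>2) j"
    unfolding cls by auto
  then have "real (card ?B) = real (card (?A M i)) - real (card (?A (M * p\<^sup>2) j))"
    by (simp add: card_Diff_subset card_mono of_nat_diff)
  moreover have "\<bar>real (card (?A M i)) - sieve_factor T * X / M\<bar> \<le> 2 ^ card T"
    using insert by auto
  moreover have "\<bar>real (card (?A (M * p\<^sup>2) j)) - sieve_factor T * X / real (M * p\<^sup>2)\<bar> \<le> 2 ^ card T"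
  proof (rule insert.IH)
    show "\<forall>q\<in>T. \<not> q dvd M * p\<^sup>2"
      using insert.prems insert.hyps primes_dvd_imp_eq prime_dvd_mult_iff prime_dvd_power
      by (metis insertCI)
  qed (use insert.prems p0 in auto)
  moreover have "sieve_factor (insert p T) * X / M
      = sieve_factor T * X / M - sieve_factor T * X / real (M * p\<^sup>2)"
    using insert.hyps p0 M by (simp add: sieve_factor_def field_simps)
  moreover have "\<bar>(a - b) - (u - v)\<bar> \<le> 2 * c" if "\<bar>a - u\<bar> \<le> c" "\<bar>b - v\<bar> \<le> c" for a b c u v :: real
    using that by linarith
  moreover have "card (insert p T) = Suc (card T)" using insert.hyps by simp
  ultimately show ?case by (simp only: power_Suc)
qed

section \<open>Large primes and the uniform sieve bound\<close>

lemma sum_inverse_squares_le: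
  assumes "y \<ge> 1"
  shows "(\<Sum>k=y+1..s. 1 / (real k)\<^sup>2) \<le> 1 / real y"
proof -
  \<comment> \<open>Telescoping with \<open>1 / (s+1)\<^sup>2 \<le> 1/s - 1/(s+1)\<close>; for
    \<open>s < y\<close> the sum is empty.\<close>
  have "(\<Sum>k=y+1..s. 1 / (real k)\<^sup>2) \<le> 1 / real y - 1 / real s" if "y \<le> s" for s
    using that
  proof (induction s rule: dec_induct)
    case (step s)
    have s: "real s > 0" using step.hyps assms by simp
    have "1 / (real (Suc s))\<^sup>2 \<le> 1 / (real s * real (Suc s))"
      using s by (intro divide_left_mono) (auto simp: power2_eq_square)
    also have "\<dots> = 1 / real s - 1 / real (Suc s)" using s by (simp add: field_simps)
    finally have "1 / (real (Suc s))\<^sup>2 \<le> 1 / real s - 1 / real (Suc s)" .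
    then show ?case using step by simp
  qed simp
  moreover have "0 \<le> 1 / real s" by simp
  ultimately show ?thesis by (cases "y \<le> s") (smt (verit), simp)
qed

text \<open>Since \<open>n + b \<le> 2 * X\<close>, only roots up to \<open>sqrt (2 * X)\<close>
  matter. Each \<open>k\<close> accounts for at most \<open>X / k\<^sup>2 + 1\<close> integers; the
  first terms sum to at most \<open>X / y\<close>, the ones to at most
  \<open>sqrt (2 * X)\<close>.\<close>

lemma card_large_squares:
  fixes X y b :: nat
  assumes "y \<ge> 1" "b \<le> X"
  shows "real (card {n\<in>{1..X}. \<exists>p>y. p\<^sup>2 dvd n + b}) \<le> X / y + sqrt (2 * X)"
proof -
  define s where "s = nat \<lfloor>sqrt (2 * X)\<rfloor>"
  have s: "real s \<le> sqrt (2 * X)" by (simp add: s_def of_nat_floor)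
  have "{n\<in>{1..X}. \<exists>p>y. p\<^sup>2 dvd n + b} \<subseteq> (\<Union>k\<in>{y+1..s}. {n\<in>{1..X}. k\<^sup>2 dvd n + b})"
  proof
    fix n assume "n \<in> {n\<in>{1..X}. \<exists>p>y. p\<^sup>2 dvd n + b}"
    then obtain p where p: "n \<in> {1..X}" "p > y" "p\<^sup>2 dvd n + b" by auto
    then have "p\<^sup>2 \<le> 2 * X" using assms dvd_imp_le[OF p(3)] by auto
    then have "(real p)\<^sup>2 \<le> 2 * real X" by (metis of_nat_le_iff of_nat_mult of_nat_numeral of_nat_power)
    then have "real p \<le> sqrt (2 * X)" by (simp add: real_le_rsqrt)
    then have "p \<le> s" by (simp add: s_def le_nat_floor)
    then show "n \<in> (\<Union>k\<in>{y+1..s}. {n\<in>{1..X}. k\<^sup>2 dvd n + b})" using p by auto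
  qed
  then have "card {n\<in>{1..X}. \<exists>p>y. p\<^sup>2 dvd n + b}
      \<le> card (\<Union>k\<in>{y+1..s}. {n\<in>{1..X}. k\<^sup>2 dvd n + b})"
    by (intro card_mono) auto
  also have "\<dots> \<le> (\<Sum>k=y+1..s. card {n\<in>{1..X}. k\<^sup>2 dvd n + b})"
    by (rule card_UN_le) simp
  finally have "real (card {n\<in>{1..X}. \<exists>p>y. p\<^sup>2 dvd n + b})
      \<le> (\<Sum>k=y+1..s. real (card {n\<in>{1..X}. k\<^sup>2 dvd n + b}))"
    unfolding of_nat_sum[symmetric] of_nat_le_iff .
  also have "\<dots> \<le> (\<Sum>k=y+1..s. real X * (1 / (real k)\<^sup>2) + 1)"
  proof (rule sum_mono)
    fix k assume "k \<in> {y+1..s}"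
    then have k: "k\<^sup>2 \<ge> 1" by simp
    obtain i where i: "k\<^sup>2 dvd i + b" using obtain_complement[OF k] .
    have "{n\<in>{1..X}. k\<^sup>2 dvd n + b} = {n\<in>{1..X}. [n = i] (mod k\<^sup>2)}"
      unfolding dvd_add_iff_cong[OF i] ..
    then show "real (card {n\<in>{1..X}. k\<^sup>2 dvd n + b}) \<le> real X * (1 / (real k)\<^sup>2) + 1"
      using card_residue_class[OF k, of X i] by simp
  qed
  also have "\<dots> = real X * (\<Sum>k=y+1..s. 1 / (real k)\<^sup>2) + real (s - y)"
    by (simp add: sum.distrib sum_distrib_left)
  also have "\<dots> \<le> real X * (1 / real y) + sqrt (2 * X)"
    using s sum_inverse_squares_le[OF assms(1), of s] by (intro add_mono mult_left_mono) auto
  finally show ?thesis by simp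
qed

text \<open>The error \<open>\<eta>\<close> is uniform in modulus, class, shift and set of dropped
  primes, so one \<open>X\<close> serves all applications. The condition on \<open>M\<close> makes
  every remaining prime coprime to the modulus.\<close>

definition sieve_bound :: "nat \<Rightarrow> real \<Rightarrow> bool" where
  "sieve_bound X \<eta> \<longleftrightarrow> (\<forall>M i b Q. M \<ge> 1 \<and> b \<le> X \<and> finite Q \<and> (\<forall>q\<in>Q. prime q) \<and>
      (\<forall>p. prime p \<and> p dvd M \<longrightarrow> p \<in> Q) \<longrightarrow>
      real (card {n\<in>{1..X}. [n = i] (mod M) \<and> (\<exists>p. prime p \<and> p \<notin> Q \<and> p\<^sup>2 dvd n + b)})
        \<le> (square_density Q / M + \<eta>) * X)"

lemma sieve_boundD:
  assumes "sieve_bound X \<eta>" "M \<ge> 1" "b \<le> X" "finite Q" "\<forall>q\<in>Q. prime q"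
    and "\<And>p. prime p \<Longrightarrow> p dvd M \<Longrightarrow> p \<in> Q"
  shows "real (card {n\<in>{1..X}. [n = i] (mod M) \<and> (\<exists>p. prime p \<and> p \<notin> Q \<and> p\<^sup>2 dvd n + b)})
        \<le> (square_density Q / M + \<eta>) * X"
  using assms unfolding sieve_bound_def by blast

text \<open>Primes up to \<open>y\<close> are sieved with an error of at most
  \<open>2 ^ (y + 1)\<close>, independent of \<open>M\<close> and \<open>Q\<close>. Larger primes
  cost \<open>X / y\<close>, at most half of \<open>\<eta> * X\<close>, and
  \<open>sqrt (2 * X)\<close>, which the other half absorbs for large \<open>X\<close>.\<close>

lemma eventually_sieve_bound:
  assumes "\<eta> > 0"
  shows "eventually (\<lambda>X. sieve_bound X \<eta>) sequentially"
proof -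
  define y where "y = nat \<lceil>2 / \<eta>\<rceil> + 1"
  have y1: "y \<ge> 1" by (simp add: y_def)
  have "2 / \<eta> \<le> real y" by (simp add: y_def) linarith
  then have y: "1 / real y \<le> \<eta> / 2" using assms y1 by (simp add: field_simps)
  have "eventually (\<lambda>X::nat. 1 + 2 ^ (y + 1) + sqrt (2 * real X) \<le> \<eta> / 2 * real X) sequentially"
    using assms by real_asymp
  then show ?thesis
  proof eventually_elim
    case (elim X)
    show ?case
      unfolding sieve_bound_def
    proof (intro allI impI, elim conjE)
      fix M i b :: nat and Q :: "nat set"
      assume M: "M \<ge> 1" and b: "b \<le> X" and Q: "finite Q" "\<forall>q\<in>Q. prime q"
        and MQ: "\<forall>p. prime p \<and> p dvd M \<longrightarrow> p \<in> Q"
      define T where "T = {p. prime p \<and> p \<le> y} - Q"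
      let ?C = "{n\<in>{1..X}. [n = i] (mod M)}"
      let ?V = "{n\<in>{1..X}. [n = i] (mod M) \<and> (\<forall>p\<in>T. \<not> p\<^sup>2 dvd n + b)}"
      let ?L = "{n\<in>{1..X}. \<exists>p>y. p\<^sup>2 dvd n + b}"
      have T: "finite T" "\<forall>p\<in>T. prime p" "T \<subseteq> {..y}" "T \<inter> Q = {}" "\<forall>p\<in>T. \<not> p dvd M"
        using MQ by (auto simp: T_def)
      have "card T \<le> y + 1" using card_mono[OF _ T(3)] by simp
      then have "(2::real) ^ card T \<le> 2 ^ (y + 1)" by (intro power_increasing) auto
      then have V: "sieve_factor T * X / M - 2 ^ (y + 1) \<le> real (card ?V)"
        using card_avoiding_squares[OF T(1,2) M T(5), of X i b] by linarith
      have "{n\<in>{1..X}. [n = i] (mod M) \<and> (\<exists>p. prime p \<and> p \<notin> Q \<and> p\<^sup>2 dvd n + b)}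
          \<subseteq> (?C - ?V) \<union> ?L" (is "?S \<subseteq> _")
      proof
        fix n assume n: "n \<in> ?S"
        then obtain p where p: "prime p" "p \<notin> Q" "p\<^sup>2 dvd n + b" by blast
        show "n \<in> (?C - ?V) \<union> ?L"
        proof (cases "p \<le> y")
          case True
          then have "p \<in> T" using p by (simp add: T_def)
          then show ?thesis using n p by auto
        next
          case False
          then have "p > y" by simp
          then show ?thesis using n p(3) by blast
        qed
      qed
      then have "card ?S \<le> card ((?C - ?V) \<union> ?L)" by (intro card_mono) auto
      also have "\<dots> \<le> card (?C - ?V) + card ?L" by (rule card_Un_le)
      also have "card (?C - ?V) = card ?C - card ?V" by (intro card_Diff_subset) auto
      finally have S: "card ?S \<le> card ?C - card ?V + card ?L" .
      have "card ?V \<le> card ?C" by (intro card_mono) auto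
      then have "real (card ?S) \<le> real (card ?C) - real (card ?V) + real (card ?L)"
        using S by linarith
      moreover have "real (card ?C) \<le> X / M + 1"
        using card_residue_class[OF M, of X i] by linarith
      moreover have "real (card ?L) \<le> X / y + sqrt (2 * X)"
        by (rule card_large_squares[OF y1 b])
      moreover have "X / y \<le> \<eta> / 2 * X"
        using mult_right_mono[OF y, of "real X"] by simp
      moreover have "(1 - square_density Q) * (X / M) \<le> sieve_factor T * (X / M)"
        using sieve_factor_ge_disjoint[OF T(1,2) Q T(4)] by (intro mult_right_mono) auto
      ultimately show "real (card ?S) \<le> (square_density Q / M + \<eta>) * X"
        using V elim
        by (simp add: distrib_right left_diff_distrib flip: times_divide_eq_right)
    qed
  qed
qed

section \<open>Sets inside a single residue class\<close>

definition const_mod :: "nat \<Rightarrow> nat set \<Rightarrow> bool" where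
  "const_mod m S \<longleftrightarrow> (\<forall>a\<in>S. \<forall>b\<in>S. [a = b] (mod m))"

lemma const_mod_subset: "const_mod m S \<Longrightarrow> T \<subseteq> S \<Longrightarrow> const_mod m T"
  by (auto simp: const_mod_def)

lemma const_mod_mult:
  assumes "const_mod m S" "const_mod k S" "coprime m k"
  shows "const_mod (m * k) S"
  using assms by (auto simp: const_mod_def intro: coprime_cong_mult_nat)

lemma const_mod_dvd_add: "const_mod m {n\<in>S. m dvd k + n}"
  unfolding const_mod_def
proof (intro ballI)
  fix a b assume "a \<in> {n\<in>S. m dvd k + n}" "b \<in> {n\<in>S. m dvd k + n}"
  then have "m dvd a + k" "m dvd b + k" by (simp_all add: add.commute)
  then show "[a = b] (mod m)" using dvd_add_iff_cong by blast
qed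

text \<open>Divisibility of \<open>n + b\<close> by \<open>m\<close> forces \<open>b\<close> into
  the class of \<open>-n\<close>, and \<open>S\<close> does not fit into one class. This is how a
  prime gets dropped from the sieve.\<close>

lemma not_const_mod_imp_not_dvd_add:
  assumes "\<not> const_mod m S"
  obtains b where "b \<in> S" "\<not> m dvd n + b"
  using assms const_mod_dvd_add[of m S n] const_mod_subset
  by (metis (mono_tags, lifting) mem_Collect_eq subsetI)

lemma const_mod_dvd_add_iff:
  assumes "const_mod m S" "a \<in> S" "b \<in> S"
  shows "m dvd n + a \<longleftrightarrow> m dvd n + b" "m dvd a + n \<longleftrightarrow> m dvd b + n"
proof -
  have "[n + a = n + b] (mod m)"
    using assms by (auto simp: const_mod_def intro: cong_add)
  then show "m dvd n + a \<longleftrightarrow> m dvd n + b" by (rule cong_dvd_iff)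
  then show "m dvd a + n \<longleftrightarrow> m dvd b + n" by (simp add: add.commute)
qed

definition odd_primes :: "nat set \<Rightarrow> bool" where
  "odd_primes R \<longleftrightarrow> finite R \<and> (\<forall>q\<in>R. prime q \<and> q \<noteq> 2)"

lemma odd_primes_insert_2:
  assumes "odd_primes R"
  shows "finite (insert 2 R)" "\<forall>q\<in>insert 2 R. prime q"
  using assms by (auto simp: odd_primes_def)

lemma odd_primes_prod_squares:
  assumes "odd_primes R"
  shows "odd (\<Prod>q\<in>R. q\<^sup>2)" "prime p \<Longrightarrow> p dvd (\<Prod>q\<in>R. q\<^sup>2) \<Longrightarrow> p \<in> R"
proof -
  have R: "finite R" "\<forall>q\<in>R. prime q" "2 \<notin> R" using assms by (auto simp: odd_primes_def)
  show *: "p \<in> R" if "prime p" "p dvd (\<Prod>q\<in>R. q\<^sup>2)" for p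
  proof -
    have "\<exists>q\<in>R. p dvd q\<^sup>2"
      using that R prime_dvd_prod_iff[of R p "\<lambda>q. q\<^sup>2"] by simp
    then obtain q where "q \<in> R" "p dvd q\<^sup>2" by blast
    then show ?thesis using that R prime_dvd_power primes_dvd_imp_eq by blast
  qed
  show "odd (\<Prod>q\<in>R. q\<^sup>2)" using *[of 2] R by auto
qed

section \<open>Sumsets without squarefree elements\<close>

text \<open>The assumption \<open>one_le_eta_X\<close> turns additive constants into multiples of
  \<open>\<eta> * X\<close>, so that every count below has the form density plus error, times
  \<open>X\<close>.\<close>

locale nonsquarefree_sumset =
  fixes X :: nat and A :: "nat set" and \<eta> :: real
  assumes subset_A: "A \<subseteq> {1..X}"
    and not_squarefree_sum: "\<And>a b. a \<in> A \<Longrightarrow> b \<in> A \<Longrightarrow> \<not> squarefree (a + b)"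
    and sieve: "sieve_bound X \<eta>"
    and one_le_eta_X: "1 \<le> \<eta> * X"
    and eta_pos: "0 < \<eta>"
begin

definition part :: "nat \<Rightarrow> nat set" where
  "part i = {n\<in>A. n mod 4 = i}"

definition nbrs :: "nat \<Rightarrow> nat set" where
  "nbrs i = {b\<in>A. (i + b) mod 4 \<noteq> 0}"

lemma finite_A: "finite A"
  using subset_A finite_subset by blast

lemma part_subset: "part i \<subseteq> A" and nbrs_subset: "nbrs i \<subseteq> A"
  by (auto simp: part_def nbrs_def)

lemma finite_part: "finite (part i)"
  using finite_A part_subset finite_subset by blast

lemma square_factor:
  assumes "n \<in> part i" "b \<in> nbrs i" "\<forall>q\<in>R. \<not> q\<^sup>2 dvd n + b"
  shows "\<exists>p. prime p \<and> p \<notin> insert 2 R \<and> p\<^sup>2 dvd n + b"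
proof -
  have "\<not> squarefree (n + b)"
    using assms not_squarefree_sum[of n b] by (auto simp: part_def nbrs_def)
  then obtain x where x: "x\<^sup>2 dvd n + b" "x \<noteq> 1"
    by (auto simp: squarefree_def)
  then obtain p where p: "prime p" "p dvd x" using prime_factor_nat by blast
  then have "p\<^sup>2 dvd n + b" using x by (meson dvd_trans dvd_power_same)
  moreover have "p \<noteq> 2"
  proof
    assume "p = 2"
    then have "(n + b) mod 4 = 0" using \<open>p\<^sup>2 dvd n + b\<close> by (simp add: dvd_eq_mod_eq_0)
    moreover have "(n + b) mod 4 = (i + b) mod 4"
      using assms(1) by (metis (mono_tags, lifting) mem_Collect_eq mod_add_left_eq part_def)
    ultimately show False using assms(2) by (simp add: nbrs_def)
  qed
  ultimately show ?thesis using p assms(3) by blast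
qed

section \<open>Upper bounds by residue classes\<close>

lemma card_const_mod:
  assumes "B \<subseteq> A" "const_mod M B" "M \<ge> 1"
  shows "real (card B) \<le> (1 / M + \<eta>) * X"
proof (cases "B = {}")
  case True
  then show ?thesis using eta_pos by simp
next
  case False
  then obtain i where i: "i \<in> B" by blast
  then have "B \<subseteq> {n\<in>{1..X}. [n = i] (mod M)}"
    using assms subset_A by (auto simp: const_mod_def)
  then have "real (card B) \<le> real (card {n\<in>{1..X}. [n = i] (mod M)})"
    by (intro of_nat_mono card_mono) auto
  also have "\<dots> \<le> X / M + 1"
    using card_residue_class[OF assms(3), of X i] by linarith
  finally show ?thesis using one_le_eta_X by (simp add: algebra_simps)
qed

lemma card_const_mod_sieved:
  assumes "B \<subseteq> A" "const_mod M B" "M \<ge> 1" "b \<in> A" "odd_primes R"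
    and "\<And>p. prime p \<Longrightarrow> p dvd M \<Longrightarrow> p \<in> insert 2 R"
    and "\<And>n. n \<in> B \<Longrightarrow> \<exists>p. prime p \<and> p \<notin> insert 2 R \<and> p\<^sup>2 dvd n + b"
  shows "real (card B) \<le> (square_density (insert 2 R) / M + \<eta>) * X"
proof (cases "B = {}")
  case True
  then show ?thesis
    using eta_pos square_density_nonneg[OF odd_primes_insert_2[OF assms(5)]] by simp
next
  case False
  then obtain i where i: "i \<in> B" by blast
  then have "B \<subseteq> {n\<in>{1..X}. [n = i] (mod M) \<and> (\<exists>p. prime p \<and> p \<notin> insert 2 R \<and> p\<^sup>2 dvd n + b)}"
    (is "_ \<subseteq> ?S") using assms subset_A by (auto simp: const_mod_def)
  then have "real (card B) \<le> real (card ?S)"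
    by (intro of_nat_mono card_mono) auto
  also have "\<dots> \<le> (square_density (insert 2 R) / M + \<eta>) * X"
    using assms(4) subset_A
    by (intro sieve_boundD[OF sieve assms(3)] odd_primes_insert_2[OF assms(5)] assms(6)) auto
  finally show ?thesis .
qed

lemma const_mod_part:
  assumes "B \<subseteq> part i" "const_mod M B" "odd M"
  shows "const_mod (4 * M) B"
proof (rule const_mod_mult)
  show "const_mod 4 B" using assms(1) by (auto simp: const_mod_def part_def cong_def)
  show "coprime 4 M" using assms(3) coprime_power_left_iff[of 2 2 M] by simp
qed (rule assms(2))

text \<open>Split \<open>B\<close> modulo \<open>M\<close>. In a class outside \<open>F\<close> one
  \<open>b\<close> serves all elements, so the sieve without the primes of \<open>R\<close> applies;
  a class in \<open>F\<close> gets the trivial density \<open>1 / (4 * M)\<close>. Each of the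
  \<open>M\<close> classes costs one \<open>\<eta>\<close>.\<close>

lemma card_by_residues:
  assumes B: "B \<subseteq> part i" and M: "odd M" and F: "F \<subseteq> {..<M}"
    and R: "odd_primes R" and MR: "\<And>p. prime p \<Longrightarrow> p dvd M \<Longrightarrow> p \<in> R"
    and b: "\<And>n. n \<in> B \<Longrightarrow> n mod M \<notin> F \<Longrightarrow> \<exists>b\<in>A. \<forall>m\<in>B. [m = n] (mod M) \<longrightarrow>
              (\<exists>p. prime p \<and> p \<notin> insert 2 R \<and> p\<^sup>2 dvd m + b)"
  shows "real (card B) \<le> (square_density (insert 2 R) / 4 + card F / (4 * M) + M * \<eta>) * X"
proof -
  define d where "d = square_density (insert 2 R)"
  define C where "C c = {n\<in>B. n mod M = c}" for c
  have d: "0 \<le> d"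
    unfolding d_def by (rule square_density_nonneg[OF odd_primes_insert_2[OF R]])
  have M1: "M \<ge> 1" using M by (cases M) auto
  have BA: "B \<subseteq> A" using B part_subset by blast
  have "B = (\<Union>c<M. C c)" using M1 by (auto simp: C_def)
  then have "card B \<le> (\<Sum>c<M. card (C c))" by (metis card_UN_le finite_lessThan)
  then have "real (card B) \<le> (\<Sum>c<M. real (card (C c)))" unfolding of_nat_sum[symmetric] of_nat_le_iff .
  also have "\<dots> \<le> (\<Sum>c<M. (d / (4 * M) + (if c \<in> F then 1 / (4 * M) else 0) + \<eta>) * X)"
  proof (rule sum_mono)
    fix c assume "c \<in> {..<M}"
    have "const_mod M (C c)" by (auto simp: const_mod_def C_def cong_def)
    then have const: "const_mod (4 * M) (C c)"
      using B M by (intro const_mod_part) (auto simp: C_def)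
    have CA: "C c \<subseteq> A" using BA by (auto simp: C_def)
    show "real (card (C c)) \<le> (d / (4 * M) + (if c \<in> F then 1 / (4 * M) else 0) + \<eta>) * X"
    proof (cases "c \<in> F")
      case True
      have "real (card (C c)) \<le> (1 / real (4 * M) + \<eta>) * X"
        using M1 by (intro card_const_mod CA const) auto
      also have "\<dots> \<le> (d / (4 * M) + 1 / (4 * M) + \<eta>) * X"
        using d by (intro mult_right_mono) auto
      finally show ?thesis using True by simp
    next
      case False
      show ?thesis
      proof (cases "C c = {}")
        case True
        then show ?thesis using d eta_pos by simp
      next
        case nonempty: False
        then obtain n where n: "n \<in> B" "n mod M = c" by (auto simp: C_def)
        then obtain b where "b \<in> A" "\<forall>m\<in>B. [m = n] (mod M) \<longrightarrow>
              (\<exists>p. prime p \<and> p \<notin> insert 2 R \<and> p\<^sup>2 dvd m + b)"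
          using b False by blast
        then have "real (card (C c)) \<le> (square_density (insert 2 R) / real (4 * M) + \<eta>) * X"
        proof (intro card_const_mod_sieved[OF CA const _ _ R])
          show "p \<in> insert 2 R" if "prime p" "p dvd 4 * M" for p
          proof -
            have "p dvd (2::nat)\<^sup>2 \<or> p dvd M" using that by (simp add: prime_dvd_mult_iff)
            then show ?thesis
              using MR that prime_dvd_power primes_dvd_imp_eq two_is_prime_nat by blast
          qed
        qed (use n M1 in \<open>auto simp: C_def cong_def\<close>)
        then show ?thesis using False by (simp add: d_def)
      qed
    qed
  qed
  also have "\<dots> = (\<Sum>c<M. d / (4 * M) + (if c \<in> F then 1 / (4 * M) else 0) + \<eta>) * X"
    by (simp add: sum_distrib_right)
  also have "(\<Sum>c<M. d / (4 * M) + (if c \<in> F then 1 / (4 * M) else 0) + \<eta>)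
      = d / 4 + card F / (4 * M) + M * \<eta>"
    using F M1 by (simp add: sum.distrib sum.If_cases Int_absorb1)
  finally show ?thesis by (simp add: d_def)
qed

text \<open>One pair \<open>n\<close>, \<open>b\<close> suffices: since \<open>B\<close> lies in a
  single class modulo \<open>q\<^sup>2\<close>, the square \<open>q\<^sup>2\<close> divides no
  \<open>m + b\<close> with \<open>m \<in> B\<close>. So \<open>q\<close> is dropped on top of the
  factor \<open>1 / q\<^sup>2\<close>.\<close>

lemma card_const_mod_square:
  assumes "prime q" "q \<noteq> 2" "B \<subseteq> part i" "const_mod (q\<^sup>2) B"
    and "B \<noteq> {} \<Longrightarrow> \<exists>n\<in>B. \<exists>b\<in>nbrs i. \<not> q\<^sup>2 dvd n + b"
  shows "real (card B) \<le> (square_density {2,q} / (4 * (real q)\<^sup>2) + \<eta>) * X"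
proof (cases "B = {}")
  case True
  then show ?thesis
    using eta_pos assms square_density_nonneg[of "{2,q}"] by simp
next
  case False
  then obtain n b where n: "n \<in> B" "b \<in> nbrs i" "\<not> q\<^sup>2 dvd n + b" using assms(5) by blast
  have "real (card B) \<le> (square_density {2,q} / real (4 * q\<^sup>2) + \<eta>) * X"
  proof (rule card_const_mod_sieved[where b = b])
    show "const_mod (4 * q\<^sup>2) B"
      using assms prime_odd_nat[of q] primes_dvd_imp_eq[of 2 q]
      by (intro const_mod_part) auto
    show "\<exists>p. prime p \<and> p \<notin> {2,q} \<and> p\<^sup>2 dvd m + b" if "m \<in> B" for m
    proof (rule square_factor)
      show "\<forall>q\<in>{q}. \<not> q\<^sup>2 dvd m + b"
        using const_mod_dvd_add_iff(2)[OF assms(4) that n(1)] n(3) by simp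
    qed (use assms n that in auto)
    show "p \<in> {2,q}" if "prime p" "p dvd 4 * q\<^sup>2" for p
    proof -
      have "p dvd (2::nat)\<^sup>2 \<or> p dvd q\<^sup>2" using that by (simp add: prime_dvd_mult_iff)
      then show ?thesis
        using assms that prime_dvd_power primes_dvd_imp_eq two_is_prime_nat by blast
    qed
    show "B \<subseteq> A" "b \<in> A" using assms n part_subset nbrs_subset by blast+
    show "1 \<le> 4 * q\<^sup>2" using assms prime_gt_0_nat[of q] by simp
    show "odd_primes {q}" using assms by (simp add: odd_primes_def)
  qed
  then show ?thesis by simp
qed

lemma card_const_mod_square_nonconst:
  assumes "prime q" "q \<noteq> 2" "B \<subseteq> part i" "const_mod (q\<^sup>2) B" "\<not> const_mod (q\<^sup>2) (nbrs i)"
  shows "real (card B) \<le> (square_density {2,q} / (4 * (real q)\<^sup>2) + \<eta>) * X"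
proof (rule card_const_mod_square[OF assms(1-4)])
  assume "B \<noteq> {}"
  then obtain n where "n \<in> B" by blast
  moreover obtain b where "b \<in> nbrs i" "\<not> q\<^sup>2 dvd n + b"
    using not_const_mod_imp_not_dvd_add[OF assms(5)] .
  ultimately show "\<exists>n\<in>B. \<exists>b\<in>nbrs i. \<not> q\<^sup>2 dvd n + b" by blast
qed

lemma card_part_le:
  assumes "nbrs i \<noteq> {}"
  shows "real (card (part i)) \<le> (square_density {2} / 4 + \<eta>) * X"
proof -
  obtain b where b: "b \<in> nbrs i" using assms by blast
  have "real (card (part i)) \<le> (square_density {2} / real 4 + \<eta>) * X"
  proof (rule card_const_mod_sieved[where b = b])
    show "const_mod 4 (part i)" by (auto simp: const_mod_def part_def cong_def)
    show "p \<in> {2}" if "prime p" "p dvd 4" for p :: nat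
    proof -
      have "p dvd (2::nat)\<^sup>2" using that by simp
      then show ?thesis
        using that prime_dvd_power primes_dvd_imp_eq two_is_prime_nat by blast
    qed
    show "\<exists>p. prime p \<and> p \<notin> {2} \<and> p\<^sup>2 dvd n + b" if "n \<in> part i" for n
      using square_factor[OF that b, of "{}"] by simp
  qed (use b part_subset nbrs_subset in \<open>auto simp: odd_primes_def\<close>)
  then show ?thesis by simp
qed

text \<open>Each class modulo \<open>q\<^sup>2\<close> has its own neighbour \<open>b\<close> that
  avoids \<open>q\<^sup>2\<close>, so there are no exceptional classes.\<close>

lemma card_part_nonconst:
  assumes q: "prime q" "q \<noteq> 2" and "\<not> const_mod (q\<^sup>2) (nbrs i)"
  shows "real (card (part i)) \<le> (square_density {2,q} / 4 + (real q)\<^sup>2 * \<eta>) * X"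
proof -
  have "real (card (part i))
      \<le> (square_density {2,q} / 4 + real (card ({} :: nat set)) / (4 * real (q\<^sup>2)) + real (q\<^sup>2) * \<eta>) * X"
  proof (rule card_by_residues[OF order_refl])
    show "odd (q\<^sup>2)" using q primes_dvd_imp_eq[of 2 q] by auto
    show "p \<in> {q}" if "prime p" "p dvd q\<^sup>2" for p
      using that q prime_dvd_power primes_dvd_imp_eq by blast
    fix n assume "n \<in> part i"
    obtain b where b: "b \<in> nbrs i" "\<not> q\<^sup>2 dvd n + b"
      using not_const_mod_imp_not_dvd_add[OF assms(3)] by metis
    have "\<exists>p. prime p \<and> p \<notin> {2,q} \<and> p\<^sup>2 dvd m + b"
      if "m \<in> part i" "[m = n] (mod q\<^sup>2)" for m
    proof (rule square_factor[OF that(1) b(1)])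
      have "[m + b = n + b] (mod q\<^sup>2)" using that by (intro cong_add) auto
      then show "\<forall>q\<in>{q}. \<not> q\<^sup>2 dvd m + b" using b cong_dvd_iff by auto
    qed
    then show "\<exists>b\<in>A. \<forall>m\<in>part i. [m = n] (mod q\<^sup>2) \<longrightarrow> (\<exists>p. prime p \<and> p \<notin> {2,q} \<and> p\<^sup>2 dvd m + b)"
      using b nbrs_subset by auto
  qed (use q in \<open>auto simp: odd_primes_def\<close>)
  then show ?thesis by simp
qed

text \<open>If some \<open>n\<close> has no partner \<open>b\<close> in the part avoiding all
  \<open>q\<^sup>2\<close>, the part is covered by the classes of \<open>-n\<close> modulo these
  squares, each of which is small; \<open>le\<close> compares their total with the claim. Otherwise
  each \<open>n\<close> has such a partner, and all primes of \<open>R\<close> are dropped at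
  once.\<close>

lemma card_part_self:
  assumes self: "part i \<subseteq> nbrs i" and R: "odd_primes R"
    and nc: "\<And>q. q \<in> R \<Longrightarrow> \<not> const_mod (q\<^sup>2) (part i)"
    and le: "(\<Sum>q\<in>R. square_density {2,q} / (4 * (real q)\<^sup>2)) \<le> square_density (insert 2 R) / 4"
  shows "real (card (part i))
    \<le> (square_density (insert 2 R) / 4 + (real (\<Prod>q\<in>R. q\<^sup>2) + card R) * \<eta>) * X"
proof (cases "\<exists>n\<in>part i. \<forall>b\<in>part i. \<exists>q\<in>R. q\<^sup>2 dvd n + b")
  case True
  then obtain n where n: "n \<in> part i" "\<forall>b\<in>part i. \<exists>q\<in>R. q\<^sup>2 dvd n + b" by blast
  have fin: "finite R" using R by (simp add: odd_primes_def)
  have "part i = (\<Union>q\<in>R. {b\<in>part i. q\<^sup>2 dvd n + b})" using n by auto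
  then have "card (part i) = card (\<Union>q\<in>R. {b\<in>part i. q\<^sup>2 dvd n + b})" by (rule arg_cong)
  also have "\<dots> \<le> (\<Sum>q\<in>R. card {b\<in>part i. q\<^sup>2 dvd n + b})" by (rule card_UN_le[OF fin])
  finally have "real (card (part i)) \<le> (\<Sum>q\<in>R. real (card {b\<in>part i. q\<^sup>2 dvd n + b}))"
    unfolding of_nat_sum[symmetric] of_nat_le_iff .
  also have "\<dots> \<le> (\<Sum>q\<in>R. (square_density {2,q} / (4 * (real q)\<^sup>2) + \<eta>) * X)"
  proof (rule sum_mono)
    fix q assume q: "q \<in> R"
    show "real (card {b\<in>part i. q\<^sup>2 dvd n + b})
        \<le> (square_density {2,q} / (4 * (real q)\<^sup>2) + \<eta>) * X"
      using q R nc[OF q] self const_mod_dvd_add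
      by (intro card_const_mod_square_nonconst[where i = i])
        (auto simp: odd_primes_def dest: const_mod_subset)
  qed
  also have "\<dots> = ((\<Sum>q\<in>R. square_density {2,q} / (4 * (real q)\<^sup>2)) + card R * \<eta>) * X"
    by (simp add: sum_distrib_right sum.distrib flip: sum_distrib_right)
  also have "\<dots> \<le> (square_density (insert 2 R) / 4 + (real (\<Prod>q\<in>R. q\<^sup>2) + card R) * \<eta>) * X"
    using le eta_pos by (intro mult_right_mono add_mono) (auto simp: algebra_simps prod_nonneg)
  finally show ?thesis .
next
  case False
  define M where "M = (\<Prod>q\<in>R. q\<^sup>2)"
  have "real (card (part i)) \<le> (square_density (insert 2 R) / 4 + real (card ({} :: nat set)) / (4 * real M) + real M * \<eta>) * X"
  proof (rule card_by_residues[OF order_refl _ _ R])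
    show "odd M" "\<And>p. prime p \<Longrightarrow> p dvd M \<Longrightarrow> p \<in> R"
      using odd_primes_prod_squares[OF R] by (auto simp: M_def)
    fix n assume "n \<in> part i"
    then obtain b where b: "b \<in> part i" "\<forall>q\<in>R. \<not> q\<^sup>2 dvd n + b" using False by blast
    have "\<exists>p. prime p \<and> p \<notin> insert 2 R \<and> p\<^sup>2 dvd m + b"
      if "m \<in> part i" "[m = n] (mod M)" for m
    proof (rule square_factor[OF that(1)])
      show "\<forall>q\<in>R. \<not> q\<^sup>2 dvd m + b"
      proof
        fix q assume q: "q \<in> R"
        then have "q\<^sup>2 dvd M" using R by (auto simp: M_def odd_primes_def)
        then have "[m + b = n + b] (mod q\<^sup>2)"
          using that cong_dvd_modulus_nat by (intro cong_add) auto
        then show "\<not> q\<^sup>2 dvd m + b" using b q cong_dvd_iff by blast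
      qed
    qed (use b self in auto)
    then show "\<exists>b\<in>A. \<forall>m\<in>part i. [m = n] (mod M) \<longrightarrow> (\<exists>p. prime p \<and> p \<notin> insert 2 R \<and> p\<^sup>2 dvd m + b)"
      using b(1) part_subset by blast
  qed auto
  also have "\<dots> \<le> (square_density (insert 2 R) / 4 + (real M + card R) * \<eta>) * X"
    using eta_pos by (intro mult_right_mono) (auto simp: algebra_simps)
  finally show ?thesis by (simp add: M_def)
qed

text \<open>If \<open>a\<close>, \<open>b\<close> differ modulo \<open>m\<close> but agree modulo
  \<open>k\<close>, an element \<open>e\<close> that differs from them modulo \<open>k\<close> also
  differs modulo \<open>m\<close> from at least one of them.\<close>

lemma obtain_distinct_both:
  assumes "\<not> const_mod m S" "\<not> const_mod k S"
  obtains a b where "a \<in> S" "b \<in> S" "\<not> [a = b] (mod m)" "\<not> [a = b] (mod k)"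
proof -
  obtain a b where ab: "a \<in> S" "b \<in> S" "\<not> [a = b] (mod m)"
    using assms(1) by (auto simp: const_mod_def)
  obtain c d where cd: "c \<in> S" "d \<in> S" "\<not> [c = d] (mod k)"
    using assms(2) by (auto simp: const_mod_def)
  show ?thesis
  proof (cases "[a = b] (mod k)")
    case True
    obtain e where e: "e \<in> S" "\<not> [e = a] (mod k)" "\<not> [e = b] (mod k)"
      using cd True by (metis cong_sym cong_trans)
    have "\<not> [e = a] (mod m) \<or> \<not> [e = b] (mod m)"
      using ab by (metis cong_sym cong_trans)
    then show ?thesis using e ab that by blast
  qed (use ab that in blast)
qed

text \<open>Take two neighbours \<open>a\<close>, \<open>b\<close> that differ modulo 9 and modulo
  25. Neither serves \<open>n\<close> only if 9 divides one of \<open>n + a\<close>,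
  \<open>n + b\<close> and 25 divides the other; this leaves two exceptional classes modulo 225,
  whence the term \<open>2 / 900\<close>.\<close>

lemma card_part_nonconst_3_5:
  assumes "\<not> const_mod 9 (nbrs i)" "\<not> const_mod 25 (nbrs i)"
  shows "real (card (part i)) \<le> (square_density {2,3,5} / 4 + 2 / 900 + 225 * \<eta>) * X"
proof -
  obtain a b where a: "a \<in> nbrs i" and b: "b \<in> nbrs i"
    and ab: "\<not> [a = b] (mod 9)" "\<not> [a = b] (mod 25)"
    using obtain_distinct_both[OF assms] .
  have cop: "coprime (9::nat) 25"
  proof (rule coprimeI)
    fix d :: nat assume "d dvd 9" "d dvd 25"
    then have "d dvd 4 * 25 - 11 * 9" by (intro dvd_diff_nat dvd_mult)
    then show "is_unit d" by simp
  qed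
  \<comment> \<open>The exceptional classes \<open>u\<close> and \<open>v\<close>, with
    \<open>8 * a\<close> and \<open>24 * b\<close> standing for \<open>-a\<close> modulo 9 and
    \<open>-b\<close> modulo 25.\<close>
  obtain u where u: "u < 9 * 25" "[u = 8 * a] (mod 9)" "[u = 24 * b] (mod 25)"
    using binary_chinese_remainder_unique_nat[OF cop, of "8 * a" "24 * b"]
    by (metis zero_neq_numeral)
  obtain v where v: "v < 9 * 25" "[v = 8 * b] (mod 9)" "[v = 24 * a] (mod 25)"
    using binary_chinese_remainder_unique_nat[OF cop, of "8 * b" "24 * a"]
    by (metis zero_neq_numeral)
  have neg9: "9 dvd n + x \<longleftrightarrow> [n = 8 * x] (mod 9)" for n x :: nat
    by (rule dvd_add_iff_cong) simp
  have neg25: "25 dvd n + x \<longleftrightarrow> [n = 24 * x] (mod 25)" for n x :: nat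
    by (rule dvd_add_iff_cong) simp
  have mod_eq: "n mod 225 = w" if "[n = w] (mod 9)" "[n = w] (mod 25)" "w < 9 * 25" for n w :: nat
  proof -
    have "[n = w] (mod 9 * 25)" using that cop by (intro coprime_cong_mult_nat)
    then show ?thesis using that by (simp add: cong_def)
  qed
  have nu: "n mod 225 = u" if "9 dvd n + a" "25 dvd n + b" for n
    using that u mod_eq[of n u] unfolding neg9 neg25 by (meson cong_sym cong_trans)
  have nv: "n mod 225 = v" if "9 dvd n + b" "25 dvd n + a" for n
    using that v mod_eq[of n v] unfolding neg9 neg25 by (meson cong_sym cong_trans)
  have neq: "\<not> (9 dvd n + a \<and> 9 dvd n + b)" "\<not> (25 dvd n + a \<and> 25 dvd n + b)" for n
    using ab const_mod_dvd_add[of 9 UNIV n] const_mod_dvd_add[of 25 UNIV n]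
    by (auto simp: const_mod_def)
  have R: "odd_primes {3,5}" by (simp add: odd_primes_def)
  have "real (card (part i))
      \<le> (square_density {2,3,5} / 4 + card {u,v} / (4 * real 225) + real 225 * \<eta>) * X"
  proof (rule card_by_residues[OF order_refl _ _ R])
    show "p \<in> {3,5}" if "prime p" "p dvd 225" for p :: nat
      using odd_primes_prod_squares(2)[OF R that(1)] that(2) by simp
    fix n assume n: "n \<in> part i" "n mod 225 \<notin> {u,v}"
    have "\<not> (9 dvd n + a \<and> 25 dvd n + b)" "\<not> (25 dvd n + a \<and> 9 dvd n + b)"
      using n nu nv by auto
    then obtain c where c: "c \<in> {a,b}" "\<not> 9 dvd n + c" "\<not> 25 dvd n + c"
      using neq by blast
    have "\<exists>p. prime p \<and> p \<notin> {2,3,5} \<and> p\<^sup>2 dvd m + c"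
      if "m \<in> part i" "[m = n] (mod 225)" for m
    proof (rule square_factor[OF that(1)])
      show "c \<in> nbrs i" using a b c by blast
      have "[m = n] (mod 9)" "[m = n] (mod 25)"
        using that(2) cong_dvd_modulus_nat[of m n 225 9] cong_dvd_modulus_nat[of m n 225 25]
        by simp_all
      then have "[m + c = n + c] (mod 9)" "[m + c = n + c] (mod 25)"
        by (auto intro: cong_add)
      then show "\<forall>q\<in>{3,5}. \<not> q\<^sup>2 dvd m + c"
        using c cong_dvd_iff[of "m + c" "n + c"] by auto
    qed
    then show "\<exists>c\<in>A. \<forall>m\<in>part i. [m = n] (mod 225) \<longrightarrow>
        (\<exists>p. prime p \<and> p \<notin> {2,3,5} \<and> p\<^sup>2 dvd m + c)"
      using a b c nbrs_subset by blast
  qed (use u v in auto)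
  also have "\<dots> \<le> (square_density {2,3,5} / 4 + 2 / 900 + 225 * \<eta>) * X"
    by (intro mult_right_mono) (auto simp: card_insert_if)
  finally show ?thesis .
qed

end

section \<open>The least prime that can be dropped\<close>

lemma const_mod_prod_squares:
  assumes "finite R" "\<forall>q\<in>R. prime q" "\<forall>q\<in>R. const_mod (q\<^sup>2) S"
  shows "const_mod (\<Prod>q\<in>R. q\<^sup>2) S"
  using assms
proof (induction R)
  case empty
  then show ?case by (simp add: const_mod_def)
next
  case (insert q R)
  have "coprime (q\<^sup>2) (\<Prod>r\<in>R. r\<^sup>2)"
  proof (rule prod_coprime_right)
    fix r assume "r \<in> R"
    then have "coprime q r" using insert by (auto intro!: primes_coprime)
    then show "coprime (q\<^sup>2) (r\<^sup>2)" by simp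
  qed
  then show ?case using insert by (simp add: const_mod_mult)
qed

text \<open>Euclid's argument: with \<open>s\<close> the product of the primes below \<open>p\<close> other than \<open>2\<close> and \<open>5\<close>,
  all prime factors of \<open>s - 10\<close> are at least \<open>p\<close>.\<close>

lemma prod_odd_primes_squares_ge:
  fixes p :: nat
  assumes p: "prime p" "7 \<le> p"
  defines "R \<equiv> {q. prime q \<and> q \<noteq> 2 \<and> q < p}"
  shows "15 * p\<^sup>2 \<le> 4 * (\<Prod>q\<in>R. q\<^sup>2)"
proof (cases "p = 7")
  \<comment> \<open>For \<open>p = 7\<close> the product \<open>s\<close> would be 3, below 10; the
    claim is checked directly as \<open>15 * 49 = 735 \<le> 900 = 4 * 225\<close>.\<close>
  case True
  have "R = {3,5}"
  proof
    show "R \<subseteq> {3,5}"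
    proof
      fix q assume "q \<in> R"
      then have q: "prime q" "q \<noteq> 2" "q < 7" using True by (auto simp: R_def)
      from \<open>q < 7\<close> have "q = 0 \<or> q = 1 \<or> q = 2 \<or> q = 3 \<or> q = 4 \<or> q = 5 \<or> q = 6" by presburger
      then show "q \<in> {3,5}" using q by (elim disjE) simp_all
    qed
  qed (use True in \<open>auto simp: R_def\<close>)
  then show ?thesis using True by simp
next
  case False
  define S where "S = R - {5}"
  define s where "s = \<Prod>S"
  have fin: "finite R" by (simp add: R_def)
  have S: "finite S" "3 \<in> S" "7 \<in> S" "5 \<in> R" using p False fin by (auto simp: S_def R_def)
  have pos: "0 < \<Prod>(S - {3,7})"
    by (intro prod_pos) (auto simp: S_def R_def prime_gt_0_nat)
  have "s = 3 * \<Prod>(S - {3})"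
    using S by (simp add: s_def prod.remove)
  also have "\<Prod>(S - {3}) = 7 * \<Prod>(S - {3} - {7})"
    using S by (intro prod.remove) auto
  also have "S - {3} - {7} = S - {3,7}" by auto
  finally have s21: "21 \<le> s" using pos by simp
  then have "s - 10 \<noteq> 1" by linarith
  then obtain r where r: "prime r" "r dvd s - 10" using prime_factor_nat by blast
  have "p \<le> r"
  proof (rule ccontr)
    assume "\<not> p \<le> r"
    then have rp: "r < p" by simp
    have div: "r dvd s \<longleftrightarrow> r dvd 2 * 5"
      using r(2) s21 dvd_diffD1[of r s "10::nat"] dvd_diffD[of r s "10::nat"] by auto
    have dvd_s: "t dvd s \<longleftrightarrow> t \<in> S" if "prime t" for t
    proof
      assume "t dvd s"
      then have "\<exists>q\<in>S. t dvd q"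
        using that S prime_dvd_prod_iff[of S t "\<lambda>q. q"] by (simp add: s_def)
      then show "t \<in> S" using that primes_dvd_imp_eq by (auto simp: S_def R_def)
    qed (use S in \<open>auto simp: s_def\<close>)
    \<comment> \<open>The prime \<open>r\<close> divides \<open>s\<close> exactly when it divides
      10. But \<open>S\<close> omits 2 and 5 and contains all other primes below \<open>p\<close>,
      so no \<open>r < p\<close> can do this.\<close>
    have "r \<in> S \<longleftrightarrow> r = 2 \<or> r = 5"
      using div dvd_s[OF r(1)] r(1) prime_dvd_mult_iff[OF r(1), of 2 5]
        primes_dvd_imp_eq[OF r(1), of 2] primes_dvd_imp_eq[OF r(1), of 5] by auto
    then show False using rp r(1) by (auto simp: S_def R_def)
  qed
  moreover have "r \<le> s - 10" using r(2) s21 by (intro dvd_imp_le) auto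
  ultimately have "p \<le> s" by simp
  have "(\<Prod>q\<in>R. q\<^sup>2) = (\<Prod>R)\<^sup>2" by (simp add: prod_power_distrib)
  also have "\<Prod>R = 5 * s" using S fin prod.remove[of R 5 "\<lambda>q. q"] by (simp add: s_def S_def)
  finally have "4 * (\<Prod>q\<in>R. q\<^sup>2) = 100 * s\<^sup>2" by (simp add: power_mult_distrib)
  moreover have "p\<^sup>2 \<le> s\<^sup>2" using \<open>p \<le> s\<close> by (intro power_mono) auto
  ultimately show ?thesis by linarith
qed

section \<open>One large even class with neighbours constant modulo 9\<close>

context nonsquarefree_sumset
begin

lemma part_subset_nbrs: "(i + j) mod 4 \<noteq> 0 \<Longrightarrow> part j \<subseteq> nbrs i"
  by (auto simp: part_def nbrs_def mod_add_right_eq)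

lemma mem_part_or_nbrs:
  assumes "n \<in> A" "i < 4"
  shows "n \<in> nbrs i \<or> n \<in> part ((4 - i) mod 4)"
proof (cases "n \<in> nbrs i")
  case False
  then have "(i + n) mod 4 = 0" using assms by (simp add: nbrs_def)
  then have *: "(i + n mod 4) mod 4 = 0" by (simp add: mod_add_right_eq)
  have "i = 0 \<or> i = 1 \<or> i = 2 \<or> i = 3" using assms(2) by linarith
  moreover have "n mod 4 = 0 \<or> n mod 4 = 1 \<or> n mod 4 = 2 \<or> n mod 4 = 3" by linarith
  ultimately have "n mod 4 = (4 - i) mod 4"
    by (elim disjE) (use * in \<open>simp_all only:, simp_all\<close>)
  then show ?thesis using assms by (simp add: part_def)
qed simp

lemma card_A: "card A = card (part 0) + card (part 1) + card (part 2) + card (part 3)"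
proof -
  have "A = (\<Union>i<4. part i)" by (auto simp: part_def)
  then have "card A = card (\<Union>i<4. part i)" by (rule arg_cong)
  also have "\<dots> = (\<Sum>i<4. card (part i))"
    by (rule card_UN_disjoint) (auto simp: finite_part, auto simp: part_def)
  also have "\<dots> = card (part 0) + card (part 1) + card (part 2) + card (part 3)"
    by (simp add: eval_nat_numeral)
  finally show ?thesis .
qed

lemma card_A_le:
  fixes c0 c1 c2 c3 d :: real
  assumes "real (card (part 0)) \<le> c0 * X" "real (card (part 1)) \<le> c1 * X"
    "real (card (part 2)) \<le> c2 * X" "real (card (part 3)) \<le> c3 * X" "c0 + c1 + c2 + c3 \<le> d"
  shows "real (card A) \<le> d * X"
proof -
  have "real (card A) \<le> (c0 + c1 + c2 + c3) * X"
    unfolding card_A using assms(1-4) by (simp add: algebra_simps)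
  also have "\<dots> \<le> d * X" using assms(5) by (intro mult_right_mono) auto
  finally show ?thesis .
qed

lemma card_A_le_3:
  fixes c c' d :: real
  assumes "i < 4" "real (card (part i)) \<le> c * X"
    and "\<And>j. j < 4 \<Longrightarrow> j \<noteq> i \<Longrightarrow> real (card (part j)) \<le> c' * X" and "c + 3 * c' \<le> d"
  shows "real (card A) \<le> d * X"
proof (rule card_A_le)
  let ?c = "\<lambda>j. if j = i then c else c'"
  show "real (card (part 0)) \<le> ?c 0 * X" "real (card (part 1)) \<le> ?c 1 * X"
    "real (card (part 2)) \<le> ?c 2 * X" "real (card (part 3)) \<le> ?c 3 * X"
    using assms by auto
  have "i = 0 \<or> i = 1 \<or> i = 2 \<or> i = 3" using assms(1) by auto
  then show "?c 0 + ?c 1 + ?c 2 + ?c 3 \<le> d" using assms(4) by auto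
qed

text \<open>\<open>part j\<close> consists of neighbours of \<open>i\<close>, so it lies in one
  class modulo \<open>q\<^sup>2\<close>, and a single sum not divisible by \<open>q\<^sup>2\<close>
  drops \<open>q\<close>. Such a sum comes from \<open>part i\<close> under the first alternative,
  and from an odd element under the second.\<close>

lemma card_other_parts:
  assumes q: "prime q" "q \<noteq> 2" and i: "i \<in> {0,2}" and j: "j < 4" "j \<noteq> i"
    and const: "const_mod (q\<^sup>2) (nbrs i)"
    and alt: "(\<exists>b\<in>part i. \<exists>c\<in>nbrs i. \<not> q\<^sup>2 dvd b + c) \<or> ((\<exists>n\<in>A. odd n) \<and> \<not> (\<forall>n\<in>A. q\<^sup>2 dvd n))"
  shows "real (card (part j)) \<le> (square_density {2,q} / (4 * (real q)\<^sup>2) + \<eta>) * X"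
proof -
  have ij: "(i + j) mod 4 \<noteq> 0" "(j + i) mod 4 \<noteq> 0" using i j by auto presburger+
  have ji: "part j \<subseteq> nbrs i" and ij': "part i \<subseteq> nbrs j" using ij part_subset_nbrs by auto
  show ?thesis
  proof (rule card_const_mod_square[OF q order_refl const_mod_subset[OF const ji]])
    assume "part j \<noteq> {}"
    then obtain n where n: "n \<in> part j" by blast
    show "\<exists>n\<in>part j. \<exists>b\<in>nbrs j. \<not> q\<^sup>2 dvd n + b"
    proof (cases "\<exists>b\<in>part i. \<exists>c\<in>nbrs i. \<not> q\<^sup>2 dvd b + c")
      case True
      then obtain b c where "b \<in> part i" "c \<in> nbrs i" "\<not> q\<^sup>2 dvd b + c" by blast
      then have "b \<in> nbrs j" "\<not> q\<^sup>2 dvd n + b"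
        using const_mod_dvd_add_iff(1)[OF const, of c n b] n ji ij' by (auto simp: add.commute)
      then show ?thesis using n by blast
    next
      case False
      then obtain k where k: "k \<in> A" "odd k" and ndvd: "\<not> (\<forall>n\<in>A. q\<^sup>2 dvd n)" using alt by blast
      have "(i + k) mod 4 \<noteq> 0" if "even i" for i using k(2) that by presburger
      then have nbr: "k \<in> nbrs i" if "even i" for i using k(1) that by (auto simp: nbrs_def)
      have kN: "k \<in> nbrs i" using i by (intro nbr) auto
      \<comment> \<open>If \<open>q\<^sup>2\<close> divided \<open>k\<close>, it would divide all
        neighbours of \<open>i\<close>; every other element lies in \<open>part i\<close>, where its
        sum with \<open>k\<close> is divisible by \<open>q\<^sup>2\<close>. So
        \<open>q\<^sup>2\<close> would divide all of \<open>A\<close>.\<close>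
      have "\<not> q\<^sup>2 dvd k"
      proof
        assume dk: "q\<^sup>2 dvd k"
        have "q\<^sup>2 dvd m" if m: "m \<in> A" for m
        proof (cases "m \<in> nbrs i")
          case True
          then show ?thesis using const_mod_dvd_add_iff(1)[OF const True kN, of 0] dk by simp
        next
          case m': False
          have "i < 4" "(4 - i) mod 4 = i" using i by auto
          then have "m \<in> part i" using mem_part_or_nbrs[OF m, of i] m' by auto
          then have "q\<^sup>2 dvd m + k" using False kN by blast
          then show ?thesis using dk dvd_add_left_iff by blast
        qed
        then show False using ndvd by blast
      qed
      moreover have "coprime (q\<^sup>2) 2" using q primes_coprime[of q 2] by simp
      ultimately have kk: "\<not> q\<^sup>2 dvd k + k"
        using coprime_dvd_mult_right_iff[of "q\<^sup>2" 2 k] by (simp flip: mult_2)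
      have nN: "n \<in> nbrs i" using n ji by blast
      \<comment> \<open>Both cases yield a sum congruent to \<open>2 * k\<close>:
        \<open>n + k\<close> for even \<open>j\<close>, since odd numbers are neighbours of even
        classes, and \<open>n + n\<close> for odd \<open>j\<close>.\<close>
      show ?thesis
      proof (cases "even j")
        case True
        have "\<not> q\<^sup>2 dvd n + k" using const_mod_dvd_add_iff(2)[OF const nN kN] kk by simp
        then show ?thesis using n nbr[OF True] by blast
      next
        case False
        then have "(j + j) mod 4 \<noteq> 0" by presburger
        then have "n \<in> nbrs j" using n part_subset_nbrs by blast
        moreover have "\<not> q\<^sup>2 dvd n + n"
          using const_mod_dvd_add_iff(2)[OF const nN kN, of n]
            const_mod_dvd_add_iff(1)[OF const nN kN, of k] kk by simp
        ultimately show ?thesis using n by blast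
      qed
    qed
  qed
qed

text \<open>The loss in the large part, of order \<open>1 / p\<^sup>2\<close> for the least prime \<open>p\<close> modulo whose square the
  neighbours are not constant, outweighs the other three parts, whose density is at most
  \<open>3 / \<Prod>q\<^sup>2\<close> with \<open>q\<close> ranging over the primes below \<open>p\<close>. Taking \<open>K\<close> large makes this
  uniform in \<open>p\<close>.\<close>

lemma card_le_of_const_mod_9:
  assumes i: "i \<in> {0,2}" and ne: "nbrs i \<noteq> {}" and const: "const_mod 9 (nbrs i)"
    and small: "\<And>j. j < 4 \<Longrightarrow> j \<noteq> i \<Longrightarrow> real (card (part j)) \<le> (square_density {2,3} / 36 + \<eta>) * X"
    and e: "28 * \<eta> \<le> e" "((real K)\<^sup>2 + 3) * \<eta> \<le> e" "1 / (real K)\<^sup>2 \<le> e" and K: "K \<ge> 1"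
  shows "real (card A) \<le> (delta0 + 2 * e) * X"
proof -
  have i4: "i < 4" using i by auto
  have eta4: "4 * \<eta> \<le> e" and e0: "0 \<le> e" using e(1) eta_pos by auto
  have sd2: "square_density {2} / 4 = delta0"
    by (simp add: square_density_2 delta0_eq field_simps)
  have sub: "part j \<subseteq> nbrs i" if "j < 4" "j \<noteq> i" for j
  proof (rule part_subset_nbrs)
    show "(i + j) mod 4 \<noteq> 0" using i that by auto presburger
  qed
  show ?thesis
  proof (cases "\<exists>p. prime p \<and> p \<noteq> 2 \<and> \<not> const_mod (p\<^sup>2) (nbrs i)")
    \<comment> \<open>The neighbours agree modulo squares of arbitrarily large primes, so each of
      the other parts has at most one element.\<close>
    case False
    have "real (card (part j)) \<le> \<eta> * X" if j: "j < 4" "j \<noteq> i" for j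
    proof -
      have "a = b" if ab: "a \<in> part j" "b \<in> part j" for a b
      proof -
        obtain p where p: "prime p" "p > a + b + 2" using bigger_prime by blast
        then have "[a = b] (mod p\<^sup>2)"
          using False ab sub[OF j] by (metis const_mod_def le_add2 not_less subsetD)
        moreover have "p \<le> p\<^sup>2" by (simp add: power2_eq_square)
        ultimately show ?thesis
          using p cong_less_modulus_unique_nat[of a b "p\<^sup>2"] by linarith
      qed
      then have "card (part j) \<le> 1" using finite_part by (simp add: card_le_Suc0_iff_eq)
      then show ?thesis using one_le_eta_X by linarith
    qed
    then show ?thesis
      using eta4 e0 sd2 by (intro card_A_le_3[OF i4 card_part_le[OF ne], of \<eta>]) auto
  next
    case True
    define p where "p = (LEAST p. prime p \<and> p \<noteq> 2 \<and> \<not> const_mod (p\<^sup>2) (nbrs i))"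
    have p: "prime p" "p \<noteq> 2" "\<not> const_mod (p\<^sup>2) (nbrs i)"
      using LeastI_ex[OF True] by (auto simp: p_def)
    have least: "const_mod (q\<^sup>2) (nbrs i)" if "q < p" "prime q" "q \<noteq> 2" for q
      using not_less_Least[of q "\<lambda>p. prime p \<and> p \<noteq> 2 \<and> \<not> const_mod (p\<^sup>2) (nbrs i)"] that
      by (auto simp: p_def)
    have bound_p: "real (card (part i)) \<le> (square_density {2,p} / 4 + (real p)\<^sup>2 * \<eta>) * X"
      by (rule card_part_nonconst[OF p])
    have "p \<noteq> 3" using p const by auto
    show ?thesis
    proof (cases "p = 5")
      \<comment> \<open>For \<open>p = 5\<close> the only smaller square is 9, too little for the
        product argument; the sieved bound \<open>small\<close> takes its place.\<close>
      case True
      show ?thesis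
        using e(1) eta_pos sqf_density_bounds
        by (intro card_A_le_3[OF i4 bound_p small])
          (auto simp: True square_density_2_5 square_density_2_3 delta0_eq field_simps)
    next
      case False
      have "7 \<le> p"
      proof (rule ccontr)
        assume "\<not> 7 \<le> p"
        then have "p = 0 \<or> p = 1 \<or> p = 2 \<or> p = 3 \<or> p = 4 \<or> p = 5 \<or> p = 6" by presburger
        then show False using p(1,2) False \<open>p \<noteq> 3\<close> by (elim disjE) simp_all
      qed
      define M where "M = (\<Prod>q\<in>{q. prime q \<and> q \<noteq> 2 \<and> q < p}. q\<^sup>2)"
      have M: "15 * p\<^sup>2 \<le> 4 * M"
        using prod_odd_primes_squares_ge[OF p(1) \<open>7 \<le> p\<close>] by (simp add: M_def)
      have "const_mod M (nbrs i)"
        unfolding M_def using least by (intro const_mod_prod_squares) auto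
      moreover have "odd M"
        using odd_primes_prod_squares(1)[of "{q. prime q \<and> q \<noteq> 2 \<and> q < p}"]
        by (simp add: M_def odd_primes_def)
      ultimately have "const_mod (4 * M) (part j)" if "j < 4" "j \<noteq> i" for j
        using sub[OF that] by (intro const_mod_part) (auto intro: const_mod_subset)
      then have "real (card (part j)) \<le> (1 / real (4 * M) + \<eta>) * X" if "j < 4" "j \<noteq> i" for j
        using that \<open>odd M\<close> by (intro card_const_mod part_subset) (auto intro!: Suc_leI odd_pos)
      moreover have p2: "(real p)\<^sup>2 \<ge> 49"
        using power_mono[of 7 "real p" 2] \<open>7 \<le> p\<close> by simp
      moreover have "1 / real (4 * M) \<le> 1 / (15 * (real p)\<^sup>2)"
      proof (rule divide_left_mono)
        have "real (15 * p\<^sup>2) \<le> real (4 * M)" using M by (rule of_nat_mono)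
        then show "15 * (real p)\<^sup>2 \<le> real (4 * M)" by simp
      qed (use \<open>7 \<le> p\<close> odd_pos[OF \<open>odd M\<close>] in auto)
      ultimately have others: "real (card (part j)) \<le> (1 / (15 * (real p)\<^sup>2) + \<eta>) * X"
        if "j < 4" "j \<noteq> i" for j
        using that by (meson add_right_mono mult_right_mono of_nat_0_le_iff order_trans)
      \<comment> \<open>The error \<open>(real p)\<^sup>2 * \<eta>\<close> from dropping
        \<open>p\<close> is controlled only for \<open>p < K\<close>. For larger \<open>p\<close> no
        prime is dropped: the other three parts contribute at most \<open>1 / K\<^sup>2\<close> up
        to multiples of \<open>\<eta>\<close>.\<close>
      show ?thesis
      proof (cases "p < K")
        case True
        have "((real p)\<^sup>2 + 3) * \<eta> \<le> ((real K)\<^sup>2 + 3) * \<eta>"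
          using True eta_pos by (intro mult_right_mono add_mono power_mono) auto
        then have err: "((real p)\<^sup>2 + 3) * \<eta> \<le> e" using e(2) by linarith
        \<comment> \<open>The constant \<open>0.202 = 0.606 / 3\<close> bounds
          \<open>sqf_density / 3\<close>, the coefficient of the gain from dropping
          \<open>p\<close>, from below.\<close>
        have "1 / (5 * w) \<le> 0.202 / (w - 1)" if "49 \<le> w" for w :: real
        proof -
          have "0 < w" "0 < w - 1" using that by auto
          then show ?thesis by (simp add: field_simps)
        qed
        from this[OF p2] have "1 / (5 * (real p)\<^sup>2) \<le> 0.202 / ((real p)\<^sup>2 - 1)" .
        also have "\<dots> \<le> (sqf_density / 3) / ((real p)\<^sup>2 - 1)"
          using p2 sqf_density_bounds by (intro divide_right_mono) auto
        finally have "3 * (1 / (15 * (real p)\<^sup>2)) \<le> (sqf_density / 3) / ((real p)\<^sup>2 - 1)" by simp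
        moreover have "square_density {2,p} / 4 = delta0 - (sqf_density / 3) / ((real p)\<^sup>2 - 1)"
          unfolding square_density_2_prime[OF p(1,2)] delta0_eq by (simp add: field_simps)
        ultimately show ?thesis
          using err e0 by (intro card_A_le_3[OF i4 bound_p others]) (auto simp: algebra_simps)
      next
        case False
        have "3 * (1 / (15 * (real p)\<^sup>2)) \<le> 1 / (real p)\<^sup>2"
          using \<open>7 \<le> p\<close> by (simp add: divide_left_mono)
        also have "\<dots> \<le> 1 / (real K)\<^sup>2"
          using False K by (intro divide_left_mono power_mono) auto
        finally have "3 * (1 / (15 * (real p)\<^sup>2)) \<le> e" using e(3) by simp
        then show ?thesis
          using eta4 sd2 by (intro card_A_le_3[OF i4 card_part_le[OF ne] others]) auto
      qed
    qed
  qed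
qed

end

section \<open>Case distinction modulo 9 and 25\<close>

lemmas square_density_simps =
  square_density_2 square_density_2_3 square_density_2_5 square_density_2_7
  square_density_2_3_5 square_density_2_3_5_7

context nonsquarefree_sumset
begin

lemma card_le_weaken:
  fixes c d :: real
  assumes "real n \<le> c * X" "c \<le> d"
  shows "real n \<le> d * X"
  using assms by (meson mult_right_mono of_nat_0_le_iff order_trans)

section \<open>Density bounds for the odd classes\<close>

lemma odd_part_subset_nbrs: "i \<in> {1,3} \<Longrightarrow> part i \<subseteq> nbrs i"
  by (rule part_subset_nbrs) auto

lemma card_A_odd: "i \<in> {1,3} \<Longrightarrow> card A = card (part 0) + card (part 2) + card (part i) + card (part (4 - i))"
  unfolding card_A by auto

lemma card_odd_part_const_mod:
  assumes i: "i \<in> {1,3}" and q: "prime q" "q \<noteq> 2" and const: "const_mod (q\<^sup>2) (part i)"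
    and n: "n \<in> part i" "\<not> q\<^sup>2 dvd n"
  shows "real (card (part i)) \<le> (square_density {2,q} / (4 * (real q)\<^sup>2) + \<eta>) * X"
proof (rule card_const_mod_square[OF q order_refl const])
  have "coprime (q\<^sup>2) 2" using q primes_coprime[of q 2] by simp
  then have "\<not> q\<^sup>2 dvd n + n"
    using n coprime_dvd_mult_right_iff[of "q\<^sup>2" 2 n] by (simp flip: mult_2)
  then show "\<exists>n\<in>part i. \<exists>b\<in>nbrs i. \<not> q\<^sup>2 dvd n + b"
    using n odd_part_subset_nbrs[OF i] by blast
qed

lemma card_part_const_mod_class:
  assumes "const_mod m (part i)" "odd m"
  shows "real (card (part i)) \<le> (1 / (4 * real m) + \<eta>) * X"
proof -
  have "real (card (part i)) \<le> (1 / real (4 * m) + \<eta>) * X"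
    using assms
    by (intro card_const_mod[OF part_subset const_mod_part]) (auto intro!: Suc_leI odd_pos)
  then show ?thesis by simp
qed

text \<open>Two elements of the same odd class never sum to a multiple of 4, so the class sieves
  itself. The constant 227 is \<open>9 * 25 + 2\<close>.\<close>

lemma card_odd_part_nonconst_3_5:
  assumes i: "i \<in> {1,3}" and "\<not> const_mod 9 (part i)" "\<not> const_mod 25 (part i)"
  shows "real (card (part i)) \<le> (square_density {2,3,5} / 4 + 227 * \<eta>) * X"
proof -
  have "real (card (part i)) \<le> (square_density (insert 2 {3,5}) / 4
      + (real (\<Prod>q\<in>{3,5}. q\<^sup>2) + card {3::nat,5}) * \<eta>) * X"
  proof (rule card_part_self[OF odd_part_subset_nbrs[OF i]])
    show "(\<Sum>q\<in>{3,5}. square_density {2,q} / (4 * (real q)\<^sup>2)) \<le> square_density (insert 2 {3,5}) / 4"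
      using sqf_density_bounds by (simp add: square_density_simps field_simps)
  qed (use assms in \<open>auto simp: odd_primes_def\<close>)
  then show ?thesis by simp
qed

text \<open>If the class is constant modulo 9, the sum \<open>n + n\<close> drops 3; if it is
  constant modulo 25, density \<open>1/100\<close> is small enough; otherwise it sieves itself. The
  last bound is the largest.\<close>

lemma card_odd_part_not_9:
  assumes i: "i \<in> {1,3}" and n: "n \<in> part i" "\<not> 9 dvd n"
  shows "real (card (part i)) \<le> (square_density {2,3,5} / 4 + 227 * \<eta>) * X"
proof -
  consider "const_mod 9 (part i)" | "const_mod 25 (part i)"
    | "\<not> const_mod 9 (part i)" "\<not> const_mod 25 (part i)" by blast
  then show ?thesis
  proof cases
    case 1
    then have "real (card (part i)) \<le> (square_density {2,3} / (4 * (real 3)\<^sup>2) + \<eta>) * X"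
      using n by (intro card_odd_part_const_mod[OF i]) auto
    then show ?thesis
      by (rule card_le_weaken)
        (use eta_pos sqf_density_bounds in \<open>auto simp: square_density_simps field_simps\<close>)
  next
    case 2
    then have "real (card (part i)) \<le> (1 / (4 * real 25) + \<eta>) * X"
      by (rule card_part_const_mod_class) simp
    then show ?thesis
      by (rule card_le_weaken)
        (use eta_pos sqf_density_bounds in \<open>auto simp: square_density_simps field_simps\<close>)
  next
    case 3
    then show ?thesis by (rule card_odd_part_nonconst_3_5[OF i])
  qed
qed

lemma card_part_dvd_9:
  assumes "\<forall>n\<in>part i. 9 dvd n"
  shows "real (card (part i)) \<le> (1/36 + \<eta>) * X"
proof -
  have "const_mod 9 (part i)"
    using assms by (auto simp: const_mod_def cong_def dvd_eq_mod_eq_0)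
  then show ?thesis using card_part_const_mod_class[of 9 i] by simp
qed

lemma card_odd_part:
  assumes i: "i \<in> {1,3}"
  shows "real (card (part i)) \<le> (1/36 + 227 * \<eta>) * X"
proof (cases "\<forall>n\<in>part i. 9 dvd n")
  case True
  from card_part_dvd_9[OF this] show ?thesis
    by (rule card_le_weaken) (use eta_pos in simp)
next
  case False
  then obtain n where "n \<in> part i" "\<not> 9 dvd n" by blast
  from card_odd_part_not_9[OF i this] show ?thesis
    by (rule card_le_weaken)
      (use sqf_density_bounds in \<open>auto simp: square_density_simps field_simps\<close>)
qed

text \<open>Improves \<open>1/36\<close> when all elements are multiples of 9: they lie in one class
  modulo 9 but their neighbours do not, so 3 is dropped.\<close>

lemma card_odd_part_nonconst_nbrs:
  assumes i: "i \<in> {1,3}" and nc: "\<not> const_mod 9 (nbrs i)"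
  shows "real (card (part i)) \<le> (square_density {2,3,5} / 4 + 227 * \<eta>) * X"
proof (cases "\<forall>n\<in>part i. 9 dvd n")
  case True
  then have "const_mod (3\<^sup>2) (part i)"
    by (auto simp: const_mod_def cong_def dvd_eq_mod_eq_0)
  then have "real (card (part i)) \<le> (square_density {2,3} / (4 * (real 3)\<^sup>2) + \<eta>) * X"
    using nc by (intro card_const_mod_square_nonconst[OF _ _ order_refl]) auto
  then show ?thesis
    by (rule card_le_weaken)
      (use eta_pos sqf_density_bounds in \<open>auto simp: square_density_simps field_simps\<close>)
next
  case False
  then show ?thesis using card_odd_part_not_9[OF i] by blast
qed

text \<open>If the part is constant modulo 9 or 25, its neighbours drop that prime; if constant
  modulo 49, the trivial bound is enough; otherwise it sieves itself by 3, 5 and 7. The constant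
  11028 is \<open>9 * 25 * 49 + 3\<close>.\<close>

lemma card_odd_part_nonconst_nbrs_3_5:
  assumes i: "i \<in> {1,3}" and nc: "\<not> const_mod 9 (nbrs i)" "\<not> const_mod 25 (nbrs i)"
  shows "real (card (part i)) \<le> (square_density {2,3,5,7} / 4 + 11028 * \<eta>) * X"
proof -
  consider "const_mod 9 (part i)" | "const_mod 25 (part i)" | "const_mod 49 (part i)"
    | "\<not> const_mod 9 (part i)" "\<not> const_mod 25 (part i)" "\<not> const_mod 49 (part i)" by blast
  then show ?thesis
  proof cases
    case 1
    then have "real (card (part i)) \<le> (square_density {2,3} / (4 * (real 3)\<^sup>2) + \<eta>) * X"
      using nc by (intro card_const_mod_square_nonconst[OF _ _ order_refl]) auto
    then show ?thesis
      by (rule card_le_weaken)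
        (use eta_pos sqf_density_bounds in \<open>auto simp: square_density_simps field_simps\<close>)
  next
    case 2
    then have "real (card (part i)) \<le> (square_density {2,5} / (4 * (real 5)\<^sup>2) + \<eta>) * X"
      using nc by (intro card_const_mod_square_nonconst[OF _ _ order_refl]) auto
    then show ?thesis
      by (rule card_le_weaken)
        (use eta_pos sqf_density_bounds in \<open>auto simp: square_density_simps field_simps\<close>)
  next
    case 3
    then have "real (card (part i)) \<le> (1 / (4 * real 49) + \<eta>) * X"
      by (rule card_part_const_mod_class) simp
    then show ?thesis
      by (rule card_le_weaken)
        (use eta_pos sqf_density_bounds in \<open>auto simp: square_density_simps field_simps\<close>)
  next
    case 4
    have "real (card (part i)) \<le> (square_density (insert 2 {3,5,7}) / 4
        + (real (\<Prod>q\<in>{3,5,7}. q\<^sup>2) + card {3::nat,5,7}) * \<eta>) * X"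
    proof (rule card_part_self[OF odd_part_subset_nbrs[OF i]])
      show "(\<Sum>q\<in>{3,5,7}. square_density {2,q} / (4 * (real q)\<^sup>2))
          \<le> square_density (insert 2 {3,5,7}) / 4"
        using sqf_density_bounds by (simp add: square_density_simps field_simps)
    qed (use 4 in \<open>auto simp: odd_primes_def\<close>)
    then show ?thesis by simp
  qed
qed

section \<open>Sets containing an odd element\<close>

lemma card_A_le_with_odd:
  assumes odd: "\<exists>n\<in>A. odd n" and not9: "\<not> (\<forall>n\<in>A. 9 dvd n)"
    and e: "30000 * \<eta> \<le> e" "((real K)\<^sup>2 + 3) * \<eta> \<le> e" "1 / (real K)\<^sup>2 \<le> e" and K: "K \<ge> 1"
  shows "real (card A) \<le> (delta0 + 2 * e) * X"
proof -
  have e0: "0 \<le> e" "28 * \<eta> \<le> e" using e(1) eta_pos by auto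
  have ne: "nbrs i \<noteq> {}" if "i \<in> {0,2}" for i
  proof -
    obtain n where n: "n \<in> A" "odd n" using odd by blast
    have "even i" using that by auto
    then have "(i + n) mod 4 \<noteq> 0" using n(2) by presburger
    then show ?thesis using n by (auto simp: nbrs_def)
  qed
  consider (const) i where "i \<in> {0,2}" "const_mod 9 (nbrs i)"
    | (nonconst) "\<not> const_mod 9 (nbrs 0)" "\<not> const_mod 9 (nbrs 2)" by blast
  then show ?thesis
  proof cases
    case const
    have "real (card (part j)) \<le> (square_density {2,3} / (4 * (real 3)\<^sup>2) + \<eta>) * X"
      if "j < 4" "j \<noteq> i" for j
      using const that odd not9 by (intro card_other_parts[of 3 i j]) auto
    then show ?thesis
      using const(1) e0 e K ne by (intro card_le_of_const_mod_9[OF _ _ const(2)]) auto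
  next
    case nonconst
    then have nc: "\<not> const_mod 9 (nbrs j)" if "j \<in> {0,2}" for j using that by blast
    consider (c) i where "i \<in> {1,3}" "const_mod 9 (nbrs i)"
      | (n) "\<not> const_mod 9 (nbrs 1)" "\<not> const_mod 9 (nbrs 3)" by blast
    then show ?thesis
    proof cases
      \<comment> \<open>Both even parts consist of neighbours of \<open>i\<close>, so each lies in
        one class modulo 9 while its own neighbours do not. They are tiny, and the odd parts
        decide.\<close>
      case c
      define k where "k = 4 - i"
      have k: "k \<in> {1,3}" "(4 - i) mod 4 = k" "i < 4" using c(1) by (auto simp: k_def)
      have even_parts: "real (card (part j)) \<le> (square_density {2,3} / (4 * (real 3)\<^sup>2) + \<eta>) * X"
        if j: "j \<in> {0,2}" for j
      proof (rule card_const_mod_square_nonconst[OF _ _ order_refl])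
        have "part j \<subseteq> nbrs i" using j c(1) by (intro part_subset_nbrs) auto
        then show "const_mod (3\<^sup>2) (part j)" using c(2) const_mod_subset by auto
      qed (use nc[OF j] in auto)
      \<comment> \<open>Only one odd part may have density \<open>1/36\<close>. If all odd elements
        are multiples of 9, then \<open>part i\<close> is empty: an element of it would make all
        neighbours of \<open>i\<close>, and together with \<open>part k\<close> all of
        \<open>A\<close>, multiples of 9.\<close>
      have odd_parts: "real (card (part i)) + real (card (part k))
          \<le> (square_density {2,3,5} / 4 + 1/36 + 454 * \<eta>) * X"
      proof (cases "(\<forall>n\<in>part i. 9 dvd n) \<and> (\<forall>n\<in>part k. 9 dvd n)")
        case True
        have "part i = {}"
        proof (rule ccontr)
          assume "part i \<noteq> {}"
          then obtain m where m: "m \<in> part i" by blast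
          then have mN: "m \<in> nbrs i" using odd_part_subset_nbrs[OF c(1)] by blast
          have "9 dvd n" if "n \<in> nbrs i" for n
            using const_mod_dvd_add_iff(1)[OF c(2) that mN, of 0] m True by simp
          then show False
            using not9 True mem_part_or_nbrs[OF _ k(3)] k(2) by metis
        qed
        moreover have "real (card (part k)) \<le> (square_density {2,3,5} / 4 + 1/36 + 454 * \<eta>) * X"
          using eta_pos sqf_density_bounds
          by (intro card_le_weaken[OF card_odd_part[OF k(1)]])
            (auto simp: square_density_simps field_simps)
        ultimately show ?thesis by simp
      next
        case False
        have "real (card (part i)) \<le> (square_density {2,3,5} / 4 + 227 * \<eta>) * X
            \<or> real (card (part k)) \<le> (square_density {2,3,5} / 4 + 227 * \<eta>) * X"
          using False card_odd_part_not_9[OF c(1)] card_odd_part_not_9[OF k(1)] by blast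
        then show ?thesis
          using card_odd_part[OF c(1)] card_odd_part[OF k(1)] by (auto simp: algebra_simps)
      qed
      have "real (card A) \<le> (2 * (square_density {2,3} / 36 + \<eta>)
          + (square_density {2,3,5} / 4 + 1/36 + 454 * \<eta>)) * X"
        using even_parts[of 0] even_parts[of 2] odd_parts
        unfolding card_A_odd[OF c(1)] k_def by (simp add: algebra_simps)
      then show ?thesis
        by (rule card_le_weaken)
          (use e e0 eta_pos sqf_density_bounds in \<open>auto simp: delta0_eq square_density_simps field_simps\<close>)
    next
      case n
      then have odd_part: "real (card (part i)) \<le> (square_density {2,3,5} / 4 + 227 * \<eta>) * X"
        if "i \<in> {1,3}" for i
        using that by (intro card_odd_part_nonconst_nbrs) auto
      have even_part: "real (card (part i)) \<le> (square_density {2,3} / 4 + 9 * \<eta>) * X"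
        if "i \<in> {0,2}" for i
        using card_part_nonconst[of 3 i] nc[OF that] by simp
      \<comment> \<open>The bounds collected so far add up to about 0.069, above
        \<open>delta0\<close>, which is about 0.047. So the classes modulo 25 are needed
        too.\<close>
      consider (even) i where "i \<in> {0,2}" "const_mod 25 (nbrs i)"
        | (odd) i where "i \<in> {1,3}" "const_mod 25 (nbrs i)"
        | (none) "\<And>i. i \<in> {0,1,2,3} \<Longrightarrow> \<not> const_mod 25 (nbrs i)" by blast
      then show ?thesis
      proof cases
        case even
        show ?thesis
        proof (cases "\<forall>n\<in>A. 25 dvd n")
          case True
          then have "const_mod 25 A"
            by (auto simp: const_mod_def cong_def dvd_eq_mod_eq_0)
          then have "real (card A) \<le> (1 / real 25 + \<eta>) * X"
            by (intro card_const_mod) auto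
          then show ?thesis
            by (rule card_le_weaken)
              (use e e0 eta_pos sqf_density_bounds in \<open>auto simp: delta0_eq field_simps\<close>)
        next
          case False
          have others: "real (card (part j)) \<le> (square_density {2,5} / (4 * (real 5)\<^sup>2) + \<eta>) * X"
            if "j < 4" "j \<noteq> i" for j
            using even that odd False by (intro card_other_parts[of 5 i j]) auto
          show ?thesis
          proof (rule card_A_le_3[OF _ even_part[OF even(1)] others])
            show "square_density {2,3} / 4 + 9 * \<eta>
                + 3 * (square_density {2,5} / (4 * (real 5)\<^sup>2) + \<eta>) \<le> delta0 + 2 * e"
              using e e0 eta_pos sqf_density_bounds
              by (simp add: delta0_eq square_density_simps field_simps)
          qed (use even(1) in auto)
        qed
      next
        case odd
        define k where "k = 4 - i"
        have k: "k \<in> {1,3}" using odd(1) by (auto simp: k_def)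
        have "real (card (part j)) \<le> (1 / (4 * real 25) + \<eta>) * X" if j: "j \<in> {0,2,i}" for j
        proof (rule card_part_const_mod_class)
          have "part j \<subseteq> nbrs i" using j odd(1) by (intro part_subset_nbrs) auto
          then show "const_mod 25 (part j)" using odd(2) const_mod_subset by blast
        qed simp
        from this[of 0] this[of 2] this[of i]
        have "real (card A) \<le> (3 * (1/100 + \<eta>) + (square_density {2,3,5} / 4 + 227 * \<eta>)) * X"
          using odd_part[OF k]
          unfolding card_A_odd[OF odd(1)] k_def by (simp add: algebra_simps)
        then show ?thesis
          by (rule card_le_weaken)
            (use e e0 eta_pos sqf_density_bounds in \<open>auto simp: delta0_eq square_density_simps field_simps\<close>)
      next
        case none
        show ?thesis
        proof (rule card_A_le)
          show "real (card (part 0)) \<le> (square_density {2,3,5} / 4 + 2 / 900 + 225 * \<eta>) * X"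
            "real (card (part 2)) \<le> (square_density {2,3,5} / 4 + 2 / 900 + 225 * \<eta>) * X"
            using nc none by (intro card_part_nonconst_3_5; simp)+
          show "real (card (part 1)) \<le> (square_density {2,3,5,7} / 4 + 11028 * \<eta>) * X"
            "real (card (part 3)) \<le> (square_density {2,3,5,7} / 4 + 11028 * \<eta>) * X"
            using n none by (intro card_odd_part_nonconst_nbrs_3_5; simp)+
        qed (use e e0 eta_pos sqf_density_bounds in
              \<open>auto simp: delta0_eq square_density_simps field_simps\<close>)
      qed
    qed
  qed
qed

section \<open>Sets of even integers\<close>

lemma even_structure:
  fixes a :: int
  assumes even: "\<forall>n\<in>A. even n" and not9: "\<not> (\<forall>n\<in>A. n mod 9 = 0)"
    and 2: "\<And>n. n \<in> part 2 \<Longrightarrow> int n mod 9 = a mod 9"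
    and 0: "\<And>n. n \<in> part 0 \<Longrightarrow> int n mod 9 = (- a) mod 9"
  shows "\<exists>a::int\<in>{1..8}. \<forall>n\<in>A.
           ((int n mod 4 = 2) \<longleftrightarrow> int n mod 9 = a mod 9) \<and>
           ((int n mod 4 = 0) \<longleftrightarrow> int n mod 9 = (- a) mod 9)"
proof
  have parts: "n \<in> part 0 \<or> n \<in> part 2" if "n \<in> A" for n
  proof -
    have "even n" using even that by blast
    then have "n mod 4 = 0 \<or> n mod 4 = 2" by presburger
    then show ?thesis using that by (simp add: part_def)
  qed
  \<comment> \<open>Otherwise all of \<open>A\<close> would be multiples of 9. As 9 is odd,
    \<open>a\<close> and \<open>-a\<close> then differ modulo 9, which turns the assumed
    implications into equivalences.\<close>
  have "a mod 9 \<noteq> 0"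
  proof
    assume a: "a mod 9 = 0"
    then have "(- a) mod 9 = 0" by presburger
    then have "int n mod 9 = 0" if "n \<in> A" for n using parts[OF that] 0 2 a by auto
    then have "n mod 9 = 0" if "n \<in> A" for n using that by (metis of_nat_0_eq_iff of_nat_mod of_nat_numeral)
    then show False using not9 by blast
  qed
  then show "a mod 9 \<in> {1..8}" by auto
  have ne: "a mod 9 \<noteq> (- a) mod 9" using \<open>a mod 9 \<noteq> 0\<close> by presburger
  show "\<forall>n\<in>A. ((int n mod 4 = 2) \<longleftrightarrow> int n mod 9 = a mod 9 mod 9) \<and>
           ((int n mod 4 = 0) \<longleftrightarrow> int n mod 9 = (- (a mod 9)) mod 9)"
  proof
    fix n assume n: "n \<in> A"
    have mod_eq: "a mod 9 mod 9 = a mod 9" "(- (a mod 9)) mod 9 = (- a) mod 9"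
      by (simp_all add: mod_minus_eq)
    have int4: "int n mod 4 = int (n mod 4)" by (simp add: zmod_int)
    show "((int n mod 4 = 2) \<longleftrightarrow> int n mod 9 = a mod 9 mod 9) \<and>
           ((int n mod 4 = 0) \<longleftrightarrow> int n mod 9 = (- (a mod 9)) mod 9)"
      using parts[OF n] 0[of n] 2[of n] ne unfolding mod_eq int4 by (auto simp: part_def)
  qed
qed

lemma int_mod_9_eq_neg:
  assumes "9 dvd b + c"
  shows "int b mod 9 = (- int c) mod 9"
proof -
  have "(9::int) dvd int b + int c" using assms by presburger
  then show ?thesis by (simp add: mod_eq_dvd_iff)
qed

text \<open>The classes 0 and 2 are each other's neighbours. If neither is constant modulo 9,
  dropping 3 for both suffices. Otherwise either some sum across the classes is not divisible by 9,
  and one class is tiny, or all are, and the residues are \<open>a\<close> and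
  \<open>-a\<close>.\<close>

lemma even_cases:
  assumes even: "\<forall>n\<in>A. even n"
    and not: "\<not> (\<forall>n\<in>A. n mod 4 = 0)" "\<not> (\<forall>n\<in>A. n mod 4 = 2)" "\<not> (\<forall>n\<in>A. n mod 9 = 0)"
    and e: "30000 * \<eta> \<le> e" "((real K)\<^sup>2 + 3) * \<eta> \<le> e" "1 / (real K)\<^sup>2 \<le> e" and K: "K \<ge> 1"
  shows "real (card A) \<le> (delta0 + 2 * e) * X \<or> (\<exists>a::int\<in>{1..8}. \<forall>n\<in>A.
           ((int n mod 4 = 2) \<longleftrightarrow> int n mod 9 = a mod 9) \<and>
           ((int n mod 4 = 0) \<longleftrightarrow> int n mod 9 = (- a) mod 9))"
proof -
  have e0: "0 \<le> e" "28 * \<eta> \<le> e" using e(1) eta_pos by auto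
  have mod4: "n mod 4 = 0 \<or> n mod 4 = 2" if "n \<in> A" for n
  proof -
    have "even n" using even that by blast
    then show ?thesis by presburger
  qed
  have nbrs_eq: "nbrs i = part (2 - i)" if "i \<in> {0,2}" for i
  proof -
    have two: "(2 + n) mod 4 = 0 \<longleftrightarrow> n mod 4 = 2" for n :: nat by presburger
    have "nbrs 0 = part 2" unfolding nbrs_def part_def using mod4 by fastforce
    moreover have "nbrs 2 = part 0" unfolding nbrs_def part_def two using mod4 by fastforce
    ultimately show ?thesis using that by auto
  qed
  have odd_parts: "part j = {}" if "j \<in> {1,3}" for j
    using mod4 that by (fastforce simp: part_def)
  have ne: "nbrs i \<noteq> {}" if "i \<in> {0,2}" for i
  proof -
    have "part 0 \<noteq> {}" "part 2 \<noteq> {}" using not(1,2) mod4 by (auto simp: part_def; blast)+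
    then show ?thesis using that nbrs_eq[OF that] by auto
  qed
  consider (const) i where "i \<in> {0,2}" "const_mod 9 (nbrs i)"
    | (nonconst) "\<not> const_mod 9 (nbrs 0)" "\<not> const_mod 9 (nbrs 2)" by blast
  then show ?thesis
  proof cases
    case nonconst
    have "real (card A) \<le> (delta0 + 2 * e) * X"
    proof (rule card_A_le)
      show "real (card (part 0)) \<le> (square_density {2,3} / 4 + (real 3)\<^sup>2 * \<eta>) * X"
        "real (card (part 2)) \<le> (square_density {2,3} / 4 + (real 3)\<^sup>2 * \<eta>) * X"
        using nonconst by (intro card_part_nonconst; simp)+
      show "real (card (part 1)) \<le> (0::real) * X" "real (card (part 3)) \<le> (0::real) * X"
        using odd_parts[of 1] odd_parts[of 3] by simp_all
    qed (use e e0 eta_pos sqf_density_bounds in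
          \<open>auto simp: delta0_eq square_density_simps field_simps\<close>)
    then show ?thesis ..
  next
    case const
    show ?thesis
    proof (cases "\<exists>b\<in>part i. \<exists>c\<in>nbrs i. \<not> 9 dvd b + c")
      case True
      have "real (card (part j)) \<le> (square_density {2,3} / (4 * (real 3)\<^sup>2) + \<eta>) * X"
        if "j < 4" "j \<noteq> i" for j
        using const that True by (intro card_other_parts[of 3 i j]) auto
      then have "real (card A) \<le> (delta0 + 2 * e) * X"
        using const(1) e0 e K ne by (intro card_le_of_const_mod_9[OF _ _ const(2)]) auto
      then show ?thesis ..
    next
      case False
      obtain r where r: "r \<in> nbrs i" using ne[OF const(1)] by blast
      have part_i: "int n mod 9 = (- int r) mod 9" if "n \<in> part i" for n
        using False r that by (intro int_mod_9_eq_neg) blast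
      have nbrs_i: "int n mod 9 = int r mod 9" if "n \<in> nbrs i" for n
      proof -
        have "[n = r] (mod 9)" using const(2) r that by (auto simp: const_mod_def)
        then show ?thesis by (metis cong_def of_nat_mod of_nat_numeral)
      qed
      consider "i = 0" "nbrs i = part 2" | "i = 2" "nbrs i = part 0"
        using const(1) nbrs_eq by force
      then show ?thesis
      proof cases
        case 1
        have "\<exists>a::int\<in>{1..8}. \<forall>n\<in>A.
           ((int n mod 4 = 2) \<longleftrightarrow> int n mod 9 = a mod 9) \<and>
           ((int n mod 4 = 0) \<longleftrightarrow> int n mod 9 = (- a) mod 9)"
          using 1 part_i nbrs_i by (intro even_structure[OF even not(3), of "int r"]) auto
        then show ?thesis ..
      next
        case 2
        have "\<exists>a::int\<in>{1..8}. \<forall>n\<in>A.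
           ((int n mod 4 = 2) \<longleftrightarrow> int n mod 9 = a mod 9) \<and>
           ((int n mod 4 = 0) \<longleftrightarrow> int n mod 9 = (- a) mod 9)"
          using 2 part_i nbrs_i by (intro even_structure[OF even not(3), of "- int r"]) auto
        then show ?thesis ..
      qed
    qed
  qed
qed

end

theorem theorem1:
  fixes \<epsilon> :: real
  assumes "\<epsilon> > 0"
  shows "\<exists>x0::real. \<forall>x::real. x > x0 \<longrightarrow>
    (\<forall>A :: nat set.
       A \<subseteq> {n. 1 \<le> n \<and> real n \<le> x} \<and>
       (\<forall>a\<in>A. \<forall>b\<in>A. \<not> squarefree (a + b)) \<and>
       real (card A) > (delta0 + \<epsilon>) * x
       \<longrightarrow>
       (\<forall>n\<in>A. n mod 4 = 0) \<or>
       (\<forall>n\<in>A. n mod 9 = 0) \<or>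
       (\<forall>n\<in>A. n mod 4 = 2) \<or>
       ((\<forall>n\<in>A. even n) \<and>
        (\<exists>a::int\<in>{1..8}. \<forall>n\<in>A.
           ((int n mod 4 = 2) \<longleftrightarrow> int n mod 9 = a mod 9) \<and>
           ((int n mod 4 = 0) \<longleftrightarrow> int n mod 9 = (- a) mod 9))))"
proof -
  \<comment> \<open>Halved because the final bounds lose \<open>2 * e\<close>.\<close>
  define e where "e = \<epsilon> / 2"
  have e: "e > 0" using assms by (simp add: e_def)
  define K where "K = nat \<lceil>1 / e\<rceil> + 1"
  have K1: "K \<ge> 1" by (simp add: K_def)
  have Ke: "1 / (real K)\<^sup>2 \<le> e"
  proof -
    have "1 / e \<le> real K" by (simp add: K_def) linarith
    moreover have "real K \<le> (real K)\<^sup>2" using K1 by (simp add: power2_eq_square)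
    ultimately have "1 / e \<le> (real K)\<^sup>2" by linarith
    then show ?thesis using e K1 by (simp add: field_simps)
  qed
  \<comment> \<open>The number 30000 exceeds \<open>2 * 225 + 2 * 11028 = 22506\<close>, the error
    when no neighbour set is constant modulo 9 or 25; the summand \<open>K\<^sup>2\<close> pays for
    dropping a prime below \<open>K\<close>.\<close>
  define \<eta> where "\<eta> = e / (30000 + (real K)\<^sup>2)"
  have den: "30000 + (real K)\<^sup>2 > 0" by (simp add: add_pos_nonneg)
  then have eta: "\<eta> > 0" using e by (simp add: \<eta>_def)
  have eta_e: "(30000 + (real K)\<^sup>2) * \<eta> = e" using den by (simp add: \<eta>_def)
  have eta1: "30000 * \<eta> \<le> e" and eta2: "((real K)\<^sup>2 + 3) * \<eta> \<le> e"
    using eta by (auto simp flip: eta_e)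
  have "eventually (\<lambda>X::nat. 1 \<le> \<eta> * real X) sequentially"
    using eta by real_asymp
  then have "eventually (\<lambda>X. sieve_bound X \<eta> \<and> 1 \<le> \<eta> * real X) sequentially"
    by (rule eventually_conj[OF eventually_sieve_bound[OF eta]])
  then obtain X0 where X0: "\<And>X. X \<ge> X0 \<Longrightarrow> sieve_bound X \<eta> \<and> 1 \<le> \<eta> * real X"
    unfolding eventually_sequentially by blast
  show ?thesis
  proof (intro exI[of _ "real X0"] allI impI, elim conjE)
    fix x :: real and A :: "nat set"
    assume x: "x > real X0" and A: "A \<subseteq> {n. 1 \<le> n \<and> real n \<le> x}"
      and sq: "\<forall>a\<in>A. \<forall>b\<in>A. \<not> squarefree (a + b)"
      and big: "real (card A) > (delta0 + \<epsilon>) * x"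
    define X where "X = nat \<lfloor>x\<rfloor>"
    have "X \<ge> X0" using x by (simp add: X_def le_nat_floor)
    then interpret nonsquarefree_sumset X A \<eta>
      using A sq X0[of X] eta by unfold_locales (auto simp: X_def le_nat_floor)
    \<comment> \<open>Nonnegativity allows replacing the integer \<open>X\<close> by the real
      \<open>x\<close> in the bound.\<close>
    have "0 \<le> delta0" using sqf_density_bounds by (simp add: delta0_eq)
    moreover have "real X \<le> x" using x by (simp add: X_def of_nat_floor)
    ultimately have "(delta0 + 2 * e) * X \<le> (delta0 + \<epsilon>) * x"
      using assms by (intro mult_mono) (auto simp: e_def)
    then have not: "\<not> real (card A) \<le> (delta0 + 2 * e) * X" using big by linarith
    have "(\<forall>n\<in>A. 9 dvd n) \<longleftrightarrow> (\<forall>n\<in>A. n mod 9 = 0)" by (simp add: dvd_eq_mod_eq_0)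
    then show "(\<forall>n\<in>A. n mod 4 = 0) \<or> (\<forall>n\<in>A. n mod 9 = 0) \<or> (\<forall>n\<in>A. n mod 4 = 2) \<or>
       ((\<forall>n\<in>A. even n) \<and>
        (\<exists>a::int\<in>{1..8}. \<forall>n\<in>A.
           ((int n mod 4 = 2) \<longleftrightarrow> int n mod 9 = a mod 9) \<and>
           ((int n mod 4 = 0) \<longleftrightarrow> int n mod 9 = (- a) mod 9)))"
      using card_A_le_with_odd[OF _ _ eta1 eta2 Ke K1] even_cases[OF _ _ _ _ eta1 eta2 Ke K1] not
      by blast
  qed
qed

end
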